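(* Let $C$ be a Hadamard full propelinear code of length $4t$ of type $\mathrm{HFP}(2t,2,2_{\mathbf u})$, $\mathrm{HFP}(2t,4_{\mathbf u})$ or $\mathrm{HFP}(4t_{\mathbf u},2)$. If $C$ is nonlinear, then the dimension $k$ of the kernel of $C$ satisfies $k\le 3$.
   Context: Let $\mathbb F$ be the binary field. $C_m$ denotes the cyclic group of order $m$. $\mathbf e$ is the all-zero vector and $\mathbf u$ the all-one vector. For $\pi\in S_n$ and $x\in\mathbb F^n$, $\pi(x)=(x_{\pi^{-1}(1)},\ldots,x_{\pi^{-1}(n)})$. A Hadamard code of length $n=4t$ is a set of $2n$ binary vectors consisting of the rows of a binary Hadamard matrix (a Hadamard matrix with $1$ replaced by $0$ and $-1$ replaced by $1$) and their complements. All codes are assumed to contain $\mathbf e$. A binary code $C\subseteq\mathbb F^n$ has a propelinear structure if for each $x\in C$ there is $\pi_x\in S_n$ such that for all $y\in C$: $x+\pi_x(y)\in C$, and $\pi_x\pi_y=\pi_z$ where $z=x+\pi_x(y)$. Then $C$ is a group under $x*y=x+\pi_x(y)$ (written multiplicatively), with identity $\mathbf e$. A Hadamard full propelinear code (HFP-code) is a Hadamard code with a propelinear structure such that $\pi_x$ has no fixed coordinate for every $x\in C\setminus\{\mathbf e,\mathbf u\}$, and $\pi_{\mathbf e}=\pi_{\mathbf u}=I$. Types, for an HFP-code $C$ of length $4t$: $\mathrm{HFP}(4t_{\mathbf u},2)$ means $C=\langle a\rangle\times\langle b\rangle\simeq C_{4t}\times C_2$ with $a^{2t}=\mathbf u$,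 $b^2=\mathbf e$; $\mathrm{HFP}(2t,2,2_{\mathbf u})$ means $C=\langle a\rangle\times\langle b\rangle\times\langle\mathbf u\rangle\simeq C_{2t}\times C_2\times C_2$; $\mathrm{HFP}(2t,4_{\mathbf u})$ means $C=\langle a\rangle\times\langle b\rangle\simeq C_{2t}\times C_4$ with $a^{2t}=\mathbf e$, $b^2=\mathbf u$. The kernel of $C$ is $K(C)=\{z\in\mathbb F^n : C+z=C\}$, a linear subspace contained in $C$; $k=\dim K(C)$. $C$ is linear if it is a linear subspace of $\mathbb F^n$. *)

theory Defs
  imports
    "HOL-Analysis.Analysis"
    "HOL-Library.Z2"
    "HOL-Algebra.Elementary_Groups"
begin

text \<open>
  Binary vectors of length \<open>n\<close> are elements of \<open>bit ^ 'n\<close> with \<open>n = CARD('n)\<close>, and a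
  coordinate permutation is a bijection of the index type. The vectors
  \<^bold>\<open>e\<close> and \<^bold>\<open>u\<close> are \<open>0\<close> and \<open>1\<close> of this type (both constant vectors).
\<close>

definition hadamard_matrix :: "int ^ 'n ^ 'n \<Rightarrow> bool"
  where "hadamard_matrix H \<longleftrightarrow>
    (\<forall>i j. H $ i $ j = 1 \<or> H $ i $ j = - 1) \<and>
    H ** transpose H = mat (int CARD('n))"

definition binary_matrix :: "int ^ 'n ^ 'n \<Rightarrow> bit ^ 'n ^ 'n"
  where "binary_matrix H = (\<chi> i j. if H $ i $ j = - 1 then 1 else 0)"

text \<open>
  The rows of a Hadamard matrix are pairwise orthogonal, so the set below automatically has
  \<open>2 * CARD('n)\<close> elements. All codes are assumed to contain the zero vector.
\<close>

definition hadamard_code :: "(bit ^ 'n) set \<Rightarrow> bool"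
  where "hadamard_code C \<longleftrightarrow> 0 \<in> C \<and>
    (\<exists>H. hadamard_matrix H \<and>
      C = rows (binary_matrix H) \<union> (\<lambda>x. x + 1) ` rows (binary_matrix H))"

definition perm_vec :: "('n \<Rightarrow> 'n) \<Rightarrow> bit ^ 'n \<Rightarrow> bit ^ 'n"
  where "perm_vec p x = (\<chi> i. x $ (inv_into UNIV p i))"

text \<open>Only the values of \<open>\<pi>\<close> on \<open>C\<close> matter.\<close>

definition propelinear :: "(bit ^ 'n) set \<Rightarrow> (bit ^ 'n \<Rightarrow> 'n \<Rightarrow> 'n) \<Rightarrow> bool"
  where "propelinear C \<pi> \<longleftrightarrow>
    (\<forall>x\<in>C. \<pi> x permutes UNIV \<and>
      (\<forall>y\<in>C. x + perm_vec (\<pi> x) y \<in> C \<and>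
              \<pi> x \<circ> \<pi> y = \<pi> (x + perm_vec (\<pi> x) y)))"

definition code_group :: "(bit ^ 'n) set \<Rightarrow> (bit ^ 'n \<Rightarrow> 'n \<Rightarrow> 'n) \<Rightarrow> (bit ^ 'n) monoid"
  where "code_group C \<pi> =
    \<lparr>carrier = C, monoid.mult = (\<lambda>x y. x + perm_vec (\<pi> x) y), one = 0\<rparr>"

definition HFP_code :: "(bit ^ 'n) set \<Rightarrow> (bit ^ 'n \<Rightarrow> 'n \<Rightarrow> 'n) \<Rightarrow> bool"
  where "HFP_code C \<pi> \<longleftrightarrow>
    hadamard_code C \<and> propelinear C \<pi> \<and>
    (\<forall>x \<in> C - {0, 1}. \<forall>i. \<pi> x i \<noteq> i) \<and>
    \<pi> 0 = id \<and> \<pi> 1 = id"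

text \<open>
  Internal direct products \<open>\<langle>a\<rangle> \<times> \<langle>b\<rangle>\<close> and \<open>\<langle>a\<rangle> \<times> \<langle>b\<rangle> \<times> \<langle>c\<rangle>\<close>: multiplication is an isomorphism from
  the external direct product of the generated subgroups onto the whole group.
\<close>

definition direct_product2 :: "('a, 'b) monoid_scheme \<Rightarrow> 'a \<Rightarrow> 'a \<Rightarrow> bool"
  where "direct_product2 G a b \<longleftrightarrow>
    a \<in> carrier G \<and> b \<in> carrier G \<and>
    (\<lambda>(x, y). x \<otimes>\<^bsub>G\<^esub> y)
      \<in> iso (subgroup_generated G {a} \<times>\<times> subgroup_generated G {b}) G"

definition direct_product3 :: "('a, 'b) monoid_scheme \<Rightarrow> 'a \<Rightarrow> 'a \<Rightarrow> 'a \<Rightarrow> bool"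
  where "direct_product3 G a b c \<longleftrightarrow>
    a \<in> carrier G \<and> b \<in> carrier G \<and> c \<in> carrier G \<and>
    (\<lambda>(x, y, z). x \<otimes>\<^bsub>G\<^esub> y \<otimes>\<^bsub>G\<^esub> z)
      \<in> iso (subgroup_generated G {a} \<times>\<times> subgroup_generated G {b} \<times>\<times> subgroup_generated G {c}) G"

text \<open>
  The types of HFP-codes of length \<open>4t\<close>. A displayed isomorphism such as
  \<open>\<langle>a\<rangle> \<times> \<langle>b\<rangle> \<simeq> C\<^bsub>4t\<^esub> \<times> C\<^bsub>2\<^esub>\<close> is read factor by factor.
\<close>

definition HFP_4tu_2 :: "nat \<Rightarrow> (bit ^ 'n) set \<Rightarrow> (bit ^ 'n \<Rightarrow> 'n \<Rightarrow> 'n) \<Rightarrow> bool"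
  where "HFP_4tu_2 t C \<pi> \<longleftrightarrow>
    CARD('n) = 4 * t \<and> HFP_code C \<pi> \<and>
    (let G = code_group C \<pi> in
      \<exists>a b. direct_product2 G a b \<and>
        subgroup_generated G {a} \<cong> integer_mod_group (4 * t) \<and>
        subgroup_generated G {b} \<cong> integer_mod_group 2 \<and>
        a [^]\<^bsub>G\<^esub> (2 * t) = 1 \<and> b [^]\<^bsub>G\<^esub> (2::nat) = 0)"

definition HFP_2t_2_2u :: "nat \<Rightarrow> (bit ^ 'n) set \<Rightarrow> (bit ^ 'n \<Rightarrow> 'n \<Rightarrow> 'n) \<Rightarrow> bool"
  where "HFP_2t_2_2u t C \<pi> \<longleftrightarrow>
    CARD('n) = 4 * t \<and> HFP_code C \<pi> \<and>
    (let G = code_group C \<pi> in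
      \<exists>a b. direct_product3 G a b 1 \<and>
        subgroup_generated G {a} \<cong> integer_mod_group (2 * t) \<and>
        subgroup_generated G {b} \<cong> integer_mod_group 2 \<and>
        subgroup_generated G {1} \<cong> integer_mod_group 2)"

definition HFP_2t_4u :: "nat \<Rightarrow> (bit ^ 'n) set \<Rightarrow> (bit ^ 'n \<Rightarrow> 'n \<Rightarrow> 'n) \<Rightarrow> bool"
  where "HFP_2t_4u t C \<pi> \<longleftrightarrow>
    CARD('n) = 4 * t \<and> HFP_code C \<pi> \<and>
    (let G = code_group C \<pi> in
      \<exists>a b. direct_product2 G a b \<and>
        subgroup_generated G {a} \<cong> integer_mod_group (2 * t) \<and>
        subgroup_generated G {b} \<cong> integer_mod_group 4 \<and>
        a [^]\<^bsub>G\<^esub> (2 * t) = 0 \<and> b [^]\<^bsub>G\<^esub> (2::nat) = 1)"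

definition code_kernel :: "(bit ^ 'n) set \<Rightarrow> (bit ^ 'n) set"
  where "code_kernel C = {z. (\<lambda>x. x + z) ` C = C}"

instance bit :: finite
proof
  have "UNIV = {0, 1 :: bit}" by (auto intro: bit.exhaust)
  then show "finite (UNIV :: bit set)" by (metis finite.emptyI finite.insertI)
qed

lemma bit_vec_add_self [simp]: "x + x = (0 :: bit ^ 'n)"
  by (simp add: vec_eq_iff)

lemma subspace_code_kernel: "vec.subspace (code_kernel C)"
proof -
  have add: "y + z \<in> code_kernel C" if "y \<in> code_kernel C" "z \<in> code_kernel C" for y z
  proof -
    have "(\<lambda>x. x + (y + z)) ` C = (\<lambda>x. x + z) ` ((\<lambda>x. x + y) ` C)"
      by (simp add: image_image add.assoc)
    then show ?thesis using that by (simp add: code_kernel_def)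
  qed
  have zero: "0 \<in> code_kernel C" by (simp add: code_kernel_def)
  moreover have "c *s x \<in> code_kernel C" if "x \<in> code_kernel C" for c :: bit and x
    using that zero by (cases c) simp_all
  ultimately show ?thesis using add by (auto simp: vec.subspace_def)
qed

lemma code_kernel_subset: "0 \<in> C \<Longrightarrow> code_kernel C \<subseteq> C"
  unfolding code_kernel_def by force

lemma perm_vec_add: "perm_vec p (x + y) = perm_vec p x + perm_vec p y"
  by (simp add: perm_vec_def vec_eq_iff)

lemma perm_vec_comp:
  assumes "bij p" "bij q"
  shows "perm_vec (p \<circ> q) x = perm_vec p (perm_vec q x)"
  using assms by (simp add: perm_vec_def vec_eq_iff o_inv_distrib)

lemma inj_perm_vec:
  assumes "bij p"
  shows "inj (perm_vec p)"
proof (rule injI)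
  fix x y assume eq: "perm_vec p x = perm_vec p y"
  have "x $ i = y $ i" for i
    using arg_cong[OF eq, of "\<lambda>v. v $ p i"] assms by (simp add: perm_vec_def bij_is_inj)
  then show "x = y" by (simp add: vec_eq_iff)
qed

lemma group_code_group:
  assumes pl: "propelinear C \<pi>" and zero: "0 \<in> C" and id0: "\<pi> 0 = id"
  shows "group (code_group C \<pi>)"
proof -
  let ?m = "\<lambda>x y. x + perm_vec (\<pi> x) y"
  have bij: "bij (\<pi> x)" if "x \<in> C" for x
    using pl that by (auto simp: propelinear_def permutes_imp_bij permutes_bij)
  have closed: "?m x y \<in> C" if "x \<in> C" "y \<in> C" for x y
    using pl that by (auto simp: propelinear_def)
  have comp: "\<pi> (?m x y) = \<pi> x \<circ> \<pi> y" if "x \<in> C" "y \<in> C" for x y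
    using pl that by (auto simp: propelinear_def)
  have assoc: "?m (?m x y) z = ?m x (?m y z)" if "x \<in> C" "y \<in> C" for x y z
    using that by (simp add: comp perm_vec_comp bij perm_vec_add add.assoc)
  have left: "?m 0 x = x" for x
    by (simp add: id0 perm_vec_def vec_eq_iff)
  have right: "?m x 0 = x" for x
    by (simp add: perm_vec_def vec_eq_iff)
  have right_inv: "\<exists>y\<in>C. ?m x y = 0" if x: "x \<in> C" for x
  proof -
    have "inj_on (?m x) C"
      using inj_perm_vec[OF bij[OF x]] by (auto simp: inj_on_def)
    moreover have "?m x ` C \<subseteq> C" using closed x by auto
    ultimately have "?m x ` C = C" by (intro endo_inj_surj) simp_all
    then show ?thesis using zero by (metis (no_types, lifting) imageE)
  qed
  have left_inv: "\<exists>y\<in>C. ?m y x = 0" if x: "x \<in> C" for x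
  proof -
    obtain y where y: "y \<in> C" "?m x y = 0" using right_inv[OF x] by blast
    obtain z where z: "z \<in> C" "?m y z = 0" using right_inv[OF y(1)] by blast
    have "x = ?m x (?m y z)" using z right by simp
    also have "\<dots> = ?m (?m x y) z" using assoc[OF x y(1)] by simp
    also have "\<dots> = z" using y left by simp
    finally show ?thesis using y z by blast
  qed
  show ?thesis
    by (rule groupI) (use closed assoc left left_inv zero in \<open>auto simp: code_group_def\<close>)
qed

end

theory Submission
  imports Defs "HOL-Algebra.Multiplicative_Group"
begin

text \<open>
  Let \<open>K\<close> be the kernel of the code \<open>C\<close>, \<open>k\<close> its dimension, \<open>U = {0, 1}\<close> the set of constant words and \<open>G\<close>
  the set \<open>C\<close> with the product \<open>x * y = x + \<pi>\<^sub>x(y)\<close>. In all three types \<open>G\<close> is abelian and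
  \<open>G = \<langle>a\<rangle> B\<close> with \<open>B = {0, 1, b, b + 1}\<close> and \<open>b * b \<in> U\<close>. The quotient \<open>G / U\<close> has \<open>n\<close>
  elements and acts on the \<open>n\<close> coordinates with trivial stabilisers, hence it acts regularly.

  Every \<open>\<pi>\<^sub>x\<close> maps \<open>K\<close> linearly onto itself. Let \<open>Stab\<close> be the subgroup of all \<open>x\<close> for which \<open>\<pi>\<^sub>x\<close> fixes
  \<open>K\<close> pointwise. Nonconstant words of \<open>K\<close> are balanced, so the words of \<open>K\<close> do not separate a given
  coordinate from exactly \<open>2n / |K|\<close> coordinates, and by regularity these are the images of that
  coordinate under \<open>Stab\<close>. This gives \<open>|Stab| |K| = 2 |C|\<close> (\<open>card_Stab_mult_card_kernel\<close>). Hence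
  \<open>G / Stab\<close> is a group of order \<open>2^(k-1)\<close> that acts faithfully on a space of dimension \<open>k\<close> over the
  binary field. For such an action \<open>(\<pi>\<^sub>x - 1)^k = 0\<close>, so the order of \<open>\<pi>\<^sub>x\<close> on \<open>K\<close> divides any \<open>2^d \<ge> k\<close>
  (\<open>pow_in_Stab\<close>); for \<open>k \<ge> 4\<close> one can take \<open>d = k - 2\<close>, and \<open>G / Stab\<close> is not cyclic.

  Now let \<open>k \<ge> 4\<close> and suppose that \<open>C\<close> is not linear. Since \<open>G / Stab\<close> is not cyclic, \<open>b \<notin> Stab\<close>, and
  therefore \<open>Stab = \<langle>c\<rangle> U\<close> for some \<open>c\<close>. Let \<open>m > 0\<close> be least with \<open>z = c^m \<in> K\<close>. As a vector, \<open>z\<close> is the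
  sum of the \<open>m\<close> translates of \<open>c\<close> by the powers \<open>\<pi>\<^sub>c^j\<close>, \<open>j < m\<close>. The sum of the \<open>\<plusminus>1\<close>-versions of these
  translates is constant on the orbits of \<open>Stab * K\<close>, and these are the level sets of \<open>z\<close>. It is also
  orthogonal to \<open>1\<close> and to \<open>z\<close>, because \<open>c \<notin> K\<close> is (otherwise \<open>Stab \<subseteq> K\<close> would be so small
  that \<open>C\<close> is linear), so it vanishes: at each coordinate exactly \<open>m / 2\<close> of
  the translates are \<open>1\<close>. Reducing modulo 2, \<open>z\<close> is constant. So \<open>Stab \<inter> K = U\<close>, while \<open>c^(m/2)\<close> is an
  element of \<open>Stab\<close> outside \<open>K\<close> whose square lies in \<open>U\<close> (\<open>cyclic_stabiliser_half_power\<close>).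

  This is impossible (\<open>kernel_eq_code_if_card_ge\<close>). If \<open>b \<notin> K\<close>, then \<open>K = \<langle>c'\<rangle> U\<close> with
  \<open>c'^(2^(k-2)) \<in> Stab \<inter> K = U\<close>, so \<open>|K| \<le> 2^(k-1)\<close>. If \<open>b \<in> K\<close>, then \<open>K / B\<close> is a nontrivial 2-group,
  so it contains the only element of order 2 of the cyclic group \<open>G / B\<close>, and \<open>c^(m/2)\<close> lies in \<open>K\<close>.
\<close>


section \<open>Abelian groups that are cyclic modulo a small subgroup\<close>

lemma card_le_fibres:
  assumes "finite A" and "\<And>b. b \<in> f ` A \<Longrightarrow> card {a \<in> A. f a = b} \<le> r"
  shows "card A \<le> r * card (f ` A)"
proof -
  have "card A = (\<Sum>b\<in>f ` A. card {a \<in> A. f a = b})"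
    using sum.image_gen[OF assms(1), of "\<lambda>_. 1::nat" f] by simp
  also have "\<dots> \<le> (\<Sum>b\<in>f ` A. r)" by (rule sum_mono) (rule assms(2))
  finally show ?thesis by (simp add: mult.commute)
qed

lemma (in group) subgroup_nat_pow_closed:
  assumes "subgroup H G" "x \<in> H"
  shows "x [^] (n::nat) \<in> H"
  using assms by (induction n) (auto intro: subgroup.m_closed subgroup.one_closed)

lemma (in group) subgroup_mult_cancel_right:
  assumes "subgroup H G" "x \<otimes> h \<in> H" "h \<in> H" "x \<in> carrier G"
  shows "x \<in> H"
proof -
  interpret H: subgroup H G by (rule assms(1))
  show ?thesis using H.m_closed[OF assms(2) H.m_inv_closed[OF assms(3)]] assms by (simp add: m_assoc)
qed

context comm_group
begin

text \<open>
  The exponents \<open>i\<close> for which the coset \<open>a^i B\<close> meets \<open>S\<close> are the multiples of the least positive one,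
  and any element of \<open>S\<close> in that least coset can serve as \<open>c\<close>. The exponents are natural numbers because
  in a finite group they suffice.
\<close>

lemma subgroup_over_cyclic_quotient:
  assumes fin: "finite (carrier G)" and S: "subgroup S G" and B: "subgroup B G"
    and a: "a \<in> carrier G"
    and gen: "\<And>x. x \<in> carrier G \<Longrightarrow> \<exists>i::nat. \<exists>\<beta>\<in>B. x = a [^] i \<otimes> \<beta>"
  obtains c where "c \<in> S" and "\<And>x. x \<in> S \<Longrightarrow> \<exists>i::nat. \<exists>\<beta>\<in>B \<inter> S. x = c [^] i \<otimes> \<beta>"
proof -
  interpret S: subgroup S G by (rule S)
  interpret B: subgroup B G by (rule B)
  define P where "P m \<longleftrightarrow> 0 < m \<and> (\<exists>\<beta>\<in>B. a [^] m \<otimes> \<beta> \<in> S)" for m :: nat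
  have "P (order G)"
    using a fin by (auto simp: P_def pow_order_eq_1 order_gt_0_iff_finite intro!: bexI[of _ \<one>])
  define m where "m = (LEAST m. P m)"
  have "P m" unfolding m_def using \<open>P (order G)\<close> by (rule LeastI)
  then obtain \<gamma> where m: "0 < m" and \<gamma>: "\<gamma> \<in> B" "a [^] m \<otimes> \<gamma> \<in> S" by (auto simp: P_def)
  define c where "c = a [^] m \<otimes> \<gamma>"
  have c: "c \<in> S" "c \<in> carrier G" using \<gamma> by (auto simp: c_def a)
  have "\<exists>i::nat. \<exists>\<beta>\<in>B \<inter> S. x = c [^] i \<otimes> \<beta>" if x: "x \<in> S" for x
  proof -
    have xG: "x \<in> carrier G" using x by simp
    obtain i :: nat and \<beta> where \<beta>: "\<beta> \<in> B" and xi: "x = a [^] i \<otimes> \<beta>" using gen[OF xG] by blast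
    define q r where "q = i div m" and "r = i mod m"
    have cq: "c [^] q \<in> S" using c by (simp add: subgroup_nat_pow_closed[OF S])
    have gq: "\<gamma> [^] q \<in> B" using \<gamma> by (simp add: subgroup_nat_pow_closed[OF B])
    define y where "y = x \<otimes> inv (c [^] q)"
    have yS: "y \<in> S" using x cq by (simp add: y_def)
    have iqr: "i = m * q + r" by (simp add: q_def r_def)
    have "y = (a [^] (m * q) \<otimes> a [^] r \<otimes> \<beta>) \<otimes> inv (a [^] (m * q) \<otimes> \<gamma> [^] q)"
      using a \<gamma> by (simp add: y_def xi c_def nat_pow_distrib nat_pow_pow nat_pow_mult iqr)
    also have "\<dots> = (a [^] (m * q) \<otimes> inv (a [^] (m * q))) \<otimes> (a [^] r \<otimes> (\<beta> \<otimes> inv (\<gamma> [^] q)))"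
      using a \<gamma> \<beta> gq by (simp add: inv_mult m_ac)
    also have "\<dots> = a [^] r \<otimes> (\<beta> \<otimes> inv (\<gamma> [^] q))" using a \<gamma> \<beta> gq by (simp add: r_inv)
    finally have y: "y = a [^] r \<otimes> (\<beta> \<otimes> inv (\<gamma> [^] q))" .
    have "\<not> P r" using m not_less_Least[of r P] by (simp add: r_def m_def)
    then have "r = 0" using yS y \<beta> gq by (auto simp: P_def)
    then have "y \<in> B" using y \<beta> gq by simp
    moreover have "x = c [^] q \<otimes> y" using xG c by (simp add: y_def m_comm inv_solve_left m_ac)
    ultimately show ?thesis using yS by blast
  qed
  then show thesis using that c by blast
qed

lemma card_cyclic_extension_le:
  assumes B: "subgroup B G" "finite B" and c: "c \<in> carrier G" and M: "0 < M" "c [^] M \<in> B"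
    and gen: "\<And>x. x \<in> S \<Longrightarrow> \<exists>i::nat. \<exists>\<beta>\<in>B. x = c [^] i \<otimes> \<beta>"
  shows "card S \<le> M * card B"
proof -
  interpret B: subgroup B G by (rule B)
  have "S \<subseteq> (\<lambda>(i, \<beta>). c [^] i \<otimes> \<beta>) ` ({..<M} \<times> B)"
  proof
    fix x assume "x \<in> S"
    then obtain i :: nat and \<beta> where \<beta>: "\<beta> \<in> B" and x: "x = c [^] i \<otimes> \<beta>" using gen by blast
    have q: "(c [^] M) [^] (i div M) \<in> B"
      using M by (simp add: subgroup_nat_pow_closed[OF B(1)])
    have "c [^] i = c [^] (i mod M) \<otimes> (c [^] M) [^] (i div M)"
      using c by (simp add: nat_pow_pow nat_pow_mult)
    then have "x = c [^] (i mod M) \<otimes> ((c [^] M) [^] (i div M) \<otimes> \<beta>)"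
      using x c \<beta> by (simp add: m_assoc)
    then show "x \<in> (\<lambda>(i, \<beta>). c [^] i \<otimes> \<beta>) ` ({..<M} \<times> B)"
      using M q \<beta> by (intro image_eqI[of _ _ "(i mod M, (c [^] M) [^] (i div M) \<otimes> \<beta>)"]) auto
  qed
  then have "card S \<le> card ({..<M} \<times> B)" by (rule surj_card_le[rotated]) (use B in simp)
  then show ?thesis by (simp add: card_cartesian_product)
qed

lemma pow_index_mem_subgroup:
  assumes fin: "finite (carrier G)" and H: "subgroup H G" and r: "order G = r * card H"
    and x: "x \<in> carrier G"
  shows "x [^] r \<in> H"
proof -
  interpret H: normal H G by (rule subgroup_imp_normal[OF H])
  have "card H > 0" using H fin by (metis H.finite_imp_card_positive)
  then have ord: "order (G Mod H) = r"
    using lagrange[OF H] r by (simp add: order_def FactGroup_def)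
  have "H #> x [^] r = (H #> x) [^]\<^bsub>G Mod H\<^esub> r" using x by (simp add: H.FactGroup_pow)
  also have "\<dots> = H"
    using group.pow_order_eq_1[OF H.factorgroup_is_group, of "H #> x"] x ord
    by (simp add: carrier_FactGroup)
  finally show ?thesis using x H by (metis nat_pow_closed rcos_self)
qed

text \<open>
  The quotient by \<open>B\<close> is cyclic, so \<open>z\<close> and \<open>w\<close> have the same image in it, its only element of order 2.
\<close>

lemma mult_involutions_mod_subgroup:
  assumes fin: "finite (carrier G)" and B: "subgroup B G" and a: "a \<in> carrier G"
    and gen: "\<And>x. x \<in> carrier G \<Longrightarrow> \<exists>i::nat. \<exists>\<beta>\<in>B. x = a [^] i \<otimes> \<beta>"
    and z: "z \<in> carrier G" "z \<notin> B" "z \<otimes> z \<in> B" and w: "w \<in> carrier G" "w \<notin> B" "w \<otimes> w \<in> B"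
  shows "z \<otimes> w \<in> B"
proof -
  interpret B: subgroup B G by (rule B)
  note pow = subgroup_nat_pow_closed[OF B]
  note cancel = subgroup_mult_cancel_right[OF B]
  define m where "m = (LEAST m::nat. 0 < m \<and> a [^] m \<in> B)"
  have "0 < order G \<and> a [^] order G \<in> B"
    using a fin by (simp add: pow_order_eq_1 order_gt_0_iff_finite)
  then have m: "0 < m \<and> a [^] m \<in> B" unfolding m_def by (rule LeastI)
  have dvd: "a [^] i \<in> B \<longleftrightarrow> m dvd i" for i
  proof
    assume "a [^] i \<in> B"
    moreover have "a [^] i = a [^] (i mod m) \<otimes> (a [^] m) [^] (i div m)"
      using a by (simp add: nat_pow_pow nat_pow_mult)
    ultimately have "a [^] (i mod m) \<otimes> (a [^] m) [^] (i div m) \<in> B" by simp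
    then have "a [^] (i mod m) \<in> B" by (rule cancel) (use m a in \<open>auto intro: pow\<close>)
    then have "\<not> 0 < i mod m"
      using not_less_Least[of "i mod m" "\<lambda>m::nat. 0 < m \<and> a [^] m \<in> B"] m by (auto simp: m_def[symmetric])
    then show "m dvd i" by auto
  next
    assume "m dvd i"
    then obtain l where "i = m * l" by (elim dvdE)
    then have "a [^] i = (a [^] m) [^] l" using a by (simp only: nat_pow_pow)
    then show "a [^] i \<in> B" using m pow by simp
  qed
  have coset: "\<exists>i. \<exists>\<beta>\<in>B. x = a [^] i \<otimes> \<beta> \<and> m dvd i + i \<and> \<not> m dvd i"
    if x: "x \<in> carrier G" "x \<notin> B" "x \<otimes> x \<in> B" for x
  proof -
    obtain i :: nat and \<beta> where \<beta>: "\<beta> \<in> B" and xi: "x = a [^] i \<otimes> \<beta>" using gen[OF x(1)] by blast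
    have "x \<otimes> x = a [^] (i + i) \<otimes> (\<beta> \<otimes> \<beta>)" using a \<beta> by (simp add: xi m_ac nat_pow_mult[symmetric])
    then have "a [^] (i + i) \<in> B"
      using cancel[of "a [^] (i + i)" "\<beta> \<otimes> \<beta>"] x(3) \<beta> a by simp
    then have "m dvd i + i" by (simp only: dvd)
    moreover have "\<not> m dvd i" using x \<beta> by (auto simp only: xi dvd[symmetric] B.m_closed)
    ultimately show ?thesis using \<beta> xi by blast
  qed
  obtain i \<beta> where i: "\<beta> \<in> B" "z = a [^] i \<otimes> \<beta>" "m dvd i + i" "\<not> m dvd i" using coset[OF z] by blast
  obtain j \<gamma> where j: "\<gamma> \<in> B" "w = a [^] j \<otimes> \<gamma>" "m dvd j + j" "\<not> m dvd j" using coset[OF w] by blast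
  obtain p q where p: "i + i = m * p" and q: "j + j = m * q"
    using i(3) j(3) by (elim dvdE) blast
  have odd: "odd r" if "l + l = m * r" "\<not> m dvd l" for l r
  proof
    assume "even r"
    then obtain r' where "r = 2 * r'" by (elim evenE)
    then have "l = m * r'" using that(1) by simp
    then show False using that(2) by simp
  qed
  have "even (p + q)" using odd[OF p i(4)] odd[OF q j(4)] by simp
  then obtain l where l: "p + q = 2 * l" by (elim evenE)
  have "(i + j) + (i + j) = m * (p + q)" using p q by (simp add: distrib_left)
  then have "i + j = m * l" using l by simp
  then have "m dvd i + j" by simp
  then have "a [^] (i + j) \<in> B" by (simp add: dvd)
  moreover have "z \<otimes> w = a [^] (i + j) \<otimes> (\<beta> \<otimes> \<gamma>)" using i j a by (simp add: m_ac nat_pow_mult[symmetric])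
  ultimately show ?thesis using i j by simp
qed

text \<open>
  The last iterated square of \<open>x\<close> that is not yet in \<open>B\<close> is such an element.
\<close>

lemma involution_mod_subgroup_exists:
  assumes K: "subgroup K G" "card K = 2 ^ k" and B: "subgroup B G" and x: "x \<in> K" "x \<notin> B"
  obtains w where "w \<in> K" "w \<notin> B" "w \<otimes> w \<in> B"
proof -
  interpret K: subgroup K G by (rule K)
  note pow = subgroup_nat_pow_closed[OF K(1) x(1)]
  have "x [^] (2 ^ k :: nat) = \<one>"
    using group.pow_order_eq_1[OF subgroup_imp_group[OF K(1)], of x] x K(2)
    by (simp add: order_def flip: nat_pow_consistent)
  then have ex: "x [^] (2 ^ k :: nat) \<in> B" by (simp add: subgroup.one_closed[OF B])
  define e where "e = (LEAST e. x [^] (2 ^ e :: nat) \<in> B)"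
  have e: "x [^] (2 ^ e :: nat) \<in> B" unfolding e_def using ex by (rule LeastI)
  have "e \<noteq> 0" using e x by (intro notI) (simp add: nat_pow_Suc2 numeral_eq_Suc)
  then obtain d where d: "e = Suc d" by (cases e) auto
  have "x [^] (2 ^ d :: nat) \<notin> B" using not_less_Least[of d "\<lambda>e. x [^] (2 ^ e :: nat) \<in> B"] d by (simp add: e_def)
  moreover have "x [^] (2 ^ d :: nat) \<otimes> x [^] (2 ^ d :: nat) \<in> B"
    using e x d by (simp add: nat_pow_mult mult_2)
  ultimately show thesis using that pow by blast
qed

text \<open>
  Each element of the product set has at most \<open>|H \<inter> K|\<close> factorisations, since two of them differ by
  moving an element of \<open>H \<inter> K\<close> from one factor to the other.
\<close>

lemma card_subgroup_mult_le:
  assumes fin: "finite (carrier G)" and H: "subgroup H G" and K: "subgroup K G"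
  shows "card H * card K \<le> card (H \<inter> K) * card ((\<lambda>(x, y). x \<otimes> y) ` (H \<times> K))"
proof -
  interpret H: subgroup H G by (rule H)
  interpret K: subgroup K G by (rule K)
  have finHK: "finite H" "finite K" using fin H.subset K.subset by (auto intro: finite_subset)
  have "card (H \<times> K) \<le> card (H \<inter> K) * card ((\<lambda>(x, y). x \<otimes> y) ` (H \<times> K))"
  proof (rule card_le_fibres)
    fix g assume "g \<in> (\<lambda>(x, y). x \<otimes> y) ` (H \<times> K)"
    then obtain x0 y0 where xy0: "x0 \<in> H" "y0 \<in> K" "g = x0 \<otimes> y0" by auto
    have "{p \<in> H \<times> K. (case p of (x, y) \<Rightarrow> x \<otimes> y) = g}
        \<subseteq> (\<lambda>d. (x0 \<otimes> d, inv d \<otimes> y0)) ` (H \<inter> K)"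
    proof
      fix p assume "p \<in> {p \<in> H \<times> K. (case p of (x, y) \<Rightarrow> x \<otimes> y) = g}"
      then obtain x y where p: "p = (x, y)" and xy: "x \<in> H" "y \<in> K" "x \<otimes> y = g" by auto
      define d where "d = inv x0 \<otimes> x"
      have eq: "x \<otimes> y = x0 \<otimes> y0" using xy xy0 by simp
      have [simp]: "x \<in> carrier G" "y \<in> carrier G" "x0 \<in> carrier G" "y0 \<in> carrier G"
        using xy xy0 by simp_all
      have "d \<otimes> y = inv x0 \<otimes> (x \<otimes> y)" by (simp add: d_def m_assoc)
      also have "\<dots> = y0" by (simp add: eq m_assoc[symmetric])
      finally have dy: "d \<otimes> y = y0" .
      have [simp]: "d \<in> carrier G" by (simp add: d_def)
      have "d = y0 \<otimes> inv y" using dy by (simp add: inv_solve_right)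
      then have "d \<in> K" using xy xy0 by simp
      moreover have "d \<in> H" using xy xy0 by (simp add: d_def)
      ultimately have "d \<in> H \<inter> K" by simp
      moreover have "x = x0 \<otimes> d" by (simp add: d_def m_assoc[symmetric])
      moreover have "y = inv d \<otimes> y0" using dy by (simp add: inv_solve_left)
      ultimately show "p \<in> (\<lambda>d. (x0 \<otimes> d, inv d \<otimes> y0)) ` (H \<inter> K)" unfolding p by blast
    qed
    then show "card {p \<in> H \<times> K. (case p of (x, y) \<Rightarrow> x \<otimes> y) = g} \<le> card (H \<inter> K)"
      using finHK by (meson card_image_le card_mono finite_Int finite_imageI le_trans)
  qed (use finHK in simp)
  then show ?thesis by (simp add: card_cartesian_product)
qed

end

section \<open>Hadamard codes and linear algebra over the binary field\<close>

text \<open>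
  The nontrivial character of the binary field, which turns a binary matrix back into its \<open>\<plusminus>1\<close> form.
\<close>

definition bsign :: "bit \<Rightarrow> int" where "bsign b = (if b = 1 then -1 else 1)"

lemma bsign_simps [simp]: "bsign 0 = 1" "bsign 1 = -1" by (simp_all add: bsign_def)

lemma bsign_add: "bsign (a + b) = bsign a * bsign b"
  by (cases a; cases b) simp_all

lemma bsign_square [simp]: "bsign a * bsign a = 1" by (cases a) simp_all

lemma sum_bsign: "finite A \<Longrightarrow> (\<Sum>j\<in>A. bsign (f j)) = int (card A) - 2 * int (card {j \<in> A. f j = 1})"
proof (induction A rule: finite_induct)
  case (insert x A)
  have "{j \<in> insert x A. f j = 1} = (if f x = 1 then insert x {j \<in> A. f j = 1} else {j \<in> A. f j = 1})" by auto
  then show ?case using insert by (cases "f x") auto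
qed simp

lemma sum_bit_eq_1_iff: "finite A \<Longrightarrow> (\<Sum>j\<in>A. f j :: bit) = 1 \<longleftrightarrow> odd (card {j \<in> A. f j = 1})"
proof (induction A rule: finite_induct)
  case (insert x A)
  have "{j \<in> insert x A. f j = 1} = (if f x = 1 then insert x {j \<in> A. f j = 1} else {j \<in> A. f j = 1})" by auto
  then show ?case using insert by (cases "f x"; cases "sum f A") (auto simp del: bit_not_one_iff bit_not_zero_iff)
qed simp

lemma vec_add_eq_0_iff: "x + y = (0 :: bit ^ 'n) \<longleftrightarrow> x = y"
  by (metis add.assoc add.right_neutral bit_vec_add_self add_left_cancel)

lemma vec_add_cancel2 [simp]: "x + y + y = (x :: bit ^ 'n)" by (simp add: add.assoc)

lemma hadamard_matrix_rows_orthogonal: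
  assumes "hadamard_matrix (H :: int ^ 'n ^ 'n)"
  shows "(\<Sum>k\<in>UNIV. H $ i $ k * H $ j $ k) = (if i = j then int CARD('n) else 0)"
proof -
  have "(H ** transpose H) $ i $ j = mat (int CARD('n)) $ i $ j"
    using assms by (simp add: hadamard_matrix_def)
  then show ?thesis by (simp add: matrix_matrix_mult_def transpose_def mat_def)
qed

lemma bsign_row_binary_matrix:
  assumes "hadamard_matrix H"
  shows "bsign (row i (binary_matrix H) $ k) = H $ i $ k"
  using assms by (auto simp: hadamard_matrix_def bsign_def row_def binary_matrix_def)

lemma hadamard_code_obtain_matrix:
  assumes "hadamard_code (C :: (bit ^ 'n) set)"
  obtains H where "hadamard_matrix H" and
    "C = range (\<lambda>i. row i (binary_matrix H)) \<union> (\<lambda>x. x + 1) ` range (\<lambda>i. row i (binary_matrix H))"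
proof -
  have "rows A = range (\<lambda>i. row i A)" for A :: "bit ^ 'n ^ 'n" by (auto simp: rows_def)
  then show thesis using assms that unfolding hadamard_code_def by metis
qed

lemma hadamard_code_compl:
  assumes "hadamard_code C" "x \<in> C"
  shows "x + 1 \<in> C"
proof -
  obtain R where "C = R \<union> (\<lambda>x. x + 1) ` R" using assms(1) unfolding hadamard_code_def by blast
  then show ?thesis using assms(2) by (auto simp: image_iff)
qed

lemma hadamard_code_orthogonal:
  assumes C: "hadamard_code (C :: (bit ^ 'n) set)" and "x \<in> C" "y \<in> C" "x \<noteq> y" "x \<noteq> y + 1"
  shows "(\<Sum>i\<in>UNIV. bsign (x $ i) * bsign (y $ i)) = 0"
proof -
  obtain H where H: "hadamard_matrix H" and
    C_eq: "C = range (\<lambda>i. row i (binary_matrix H)) \<union> (\<lambda>x. x + 1) ` range (\<lambda>i. row i (binary_matrix H))"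
    using hadamard_code_obtain_matrix[OF C] by blast
  have row: "\<exists>i b. z = row i (binary_matrix H) + b *s 1" if "z \<in> C" for z
  proof -
    consider i where "z = row i (binary_matrix H)" | i where "z = row i (binary_matrix H) + 1"
      using \<open>z \<in> C\<close> unfolding C_eq by blast
    then show ?thesis
    proof cases
      case 1
      then have "z = row i (binary_matrix H) + 0 *s 1" by simp
      then show ?thesis by blast
    next
      case 2
      then have "z = row i (binary_matrix H) + 1 *s 1" by simp
      then show ?thesis by blast
    qed
  qed
  obtain i b where x: "x = row i (binary_matrix H) + b *s 1" using row[OF assms(2)] by blast
  obtain j c where y: "y = row j (binary_matrix H) + c *s 1" using row[OF assms(3)] by blast
  have "i \<noteq> j" using assms(4,5) x y by (cases b; cases c) auto
  have "(\<Sum>k\<in>UNIV. bsign (x $ k) * bsign (y $ k))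
      = (\<Sum>k\<in>UNIV. bsign b * bsign c * (H $ i $ k * H $ j $ k))"
    by (rule sum.cong) (simp_all add: x y bsign_add bsign_row_binary_matrix[OF H] mult_ac del: add_bit_eq_xor)
  also have "\<dots> = bsign b * bsign c * (\<Sum>k\<in>UNIV. H $ i $ k * H $ j $ k)" by (rule sum_distrib_left[symmetric])
  finally show ?thesis using \<open>i \<noteq> j\<close> by (simp add: hadamard_matrix_rows_orthogonal[OF H])
qed

lemma card_hadamard_code:
  assumes C: "hadamard_code (C :: (bit ^ 'n) set)"
  shows "card C = 2 * CARD('n)"
proof -
  obtain H where H: "hadamard_matrix H" and
    C_eq: "C = range (\<lambda>i. row i (binary_matrix H)) \<union> (\<lambda>x. x + 1) ` range (\<lambda>i. row i (binary_matrix H))"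
    using hadamard_code_obtain_matrix[OF C] by blast
  let ?r = "\<lambda>i. row i (binary_matrix H)"
  have eq: "i = j \<and> b = 0" if "?r i = ?r j + b *s 1" for i j b
  proof -
    have "(\<Sum>k\<in>UNIV. H $ i $ k * H $ j $ k) = (\<Sum>k\<in>(UNIV :: 'n set). bsign b)"
    proof (rule sum.cong)
      fix k
      have "H $ i $ k = H $ j $ k * bsign b"
        using arg_cong[OF that, of "\<lambda>v. bsign (v $ k)"] by (simp add: bsign_add bsign_row_binary_matrix[OF H] del: add_bit_eq_xor)
      moreover have "H $ j $ k * H $ j $ k = 1"
        using bsign_square[of "?r j $ k"] by (simp add: bsign_row_binary_matrix[OF H])
      ultimately show "H $ i $ k * H $ j $ k = bsign b" by (simp add: mult_ac)
    qed simp
    then show ?thesis by (cases b) (auto simp: hadamard_matrix_rows_orthogonal[OF H] split: if_splits)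
  qed
  have "inj ?r" using eq[of _ _ 0] by (auto simp: inj_on_def)
  then have r: "card (range ?r) = CARD('n)" by (simp add: card_image)
  moreover have "card ((\<lambda>x. x + 1) ` range ?r) = card (range ?r)" by (rule card_image) (simp add: inj_on_def)
  moreover have "range ?r \<inter> (\<lambda>x. x + 1) ` range ?r = {}" using eq[of _ _ 1] by auto
  ultimately show ?thesis by (simp add: C_eq card_Un_disjoint)
qed

text \<open>
  Adding a vector \<open>a\<close> to an independent set \<open>B\<close> adjoins to \<open>span B\<close> the single disjoint coset
  \<open>span B + a\<close>.
\<close>

lemma card_vec_subspace:
  assumes "vec.subspace (S :: (bit ^ 'n) set)"
  shows "card S = 2 ^ vec.dim S"
proof -
  have span: "card (vec.span B) = 2 ^ card B" if "vec.independent B" for B :: "(bit ^ 'n) set"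
  proof -
    have "finite B" by simp
    then show ?thesis using that
    proof (induction B rule: finite_induct)
      case (insert a B)
      have ind: "vec.independent B" and a: "a \<notin> vec.span B"
        using insert by (auto simp: vec.independent_insert)
      have "vec.span (insert a B) = vec.span B \<union> (\<lambda>x. x + a) ` vec.span B"
      proof (intro equalityI subsetI)
        fix x assume "x \<in> vec.span (insert a B)"
        then obtain k :: bit where "x - k *s a \<in> vec.span B" by (auto simp: vec.span_insert)
        then show "x \<in> vec.span B \<union> (\<lambda>x. x + a) ` vec.span B"
          by (cases k) (auto intro!: image_eqI[of _ _ "x - a"])
      next
        fix x assume "x \<in> vec.span B \<union> (\<lambda>x. x + a) ` vec.span B"
        then show "x \<in> vec.span (insert a B)"
          using subsetD[OF vec.span_mono[of B "insert a B"]] vec.span_base[of a "insert a B"]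
          by (auto intro: vec.span_add)
      qed
      moreover have "vec.span B \<inter> (\<lambda>x. x + a) ` vec.span B = {}"
      proof -
        have "x + a \<notin> vec.span B" if x: "x \<in> vec.span B" for x
        proof
          assume "x + a \<in> vec.span B"
          then have "x + a - x \<in> vec.span B" using x by (rule vec.span_diff)
          then show False using a by simp
        qed
        then show ?thesis by blast
      qed
      moreover have "card ((\<lambda>x. x + a) ` vec.span B) = card (vec.span B)"
        by (rule card_image) (simp add: inj_on_def)
      ultimately show ?case using insert ind by (simp add: card_Un_disjoint)
    qed simp
  qed
  obtain B where "B \<subseteq> S" "vec.independent B" "S \<subseteq> vec.span B" "card B = vec.dim S"
    using vec.basis_exists by metis
  moreover from this assms have "vec.span B = S" by (metis vec.span_subspace)
  ultimately show ?thesis using span by metis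
qed

text \<open>
  The binomial formula in characteristic 2, applied to the commuting maps \<open>f\<close> and \<open>1\<close>.
\<close>

lemma additive_funpow_plus_id:
  fixes f :: "bit ^ 'n \<Rightarrow> bit ^ 'n"
  assumes "\<And>x y. f (x + y) = f x + f y"
  shows "((\<lambda>x. f x + x) ^^ (2 ^ e)) x = (f ^^ (2 ^ e)) x + x"
proof (induction e arbitrary: x)
  case (Suc e)
  have add: "(f ^^ m) (x + y) = (f ^^ m) x + (f ^^ m) y" for m x y
    by (induction m) (simp_all add: assms)
  have "((\<lambda>x. f x + x) ^^ (2 ^ Suc e)) x = (f ^^ (2 ^ e)) ((f ^^ (2 ^ e)) x + x) + ((f ^^ (2 ^ e)) x + x)"
    by (simp only: power_Suc mult_2 funpow_add comp_apply Suc)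
  also have "\<dots> = (f ^^ (2 ^ Suc e)) x + x"
    by (simp only: power_Suc mult_2 funpow_add comp_apply add vec_add_cancel2 flip: add.assoc)
  finally show ?case .
qed simp

text \<open>
  The map \<open>N = f + 1\<close> is nilpotent on \<open>V\<close>. As long as the image of \<open>N^i\<close> is not zero, \<open>N\<close> has a nonzero
  kernel vector in it and at least halves its size; so \<open>N^k = 0\<close>, hence \<open>f^(2^d) + 1 = N^(2^d) = 0\<close>.
\<close>

lemma unipotent_funpow_eq_id:
  fixes f :: "bit ^ 'n \<Rightarrow> bit ^ 'n" and V :: "(bit ^ 'n) set"
  assumes f: "\<And>x y. f (x + y) = f x + f y" and fV: "f ` V \<subseteq> V"
    and V: "0 \<in> V" "\<And>x y. x \<in> V \<Longrightarrow> y \<in> V \<Longrightarrow> x + y \<in> V" "card V \<le> 2 ^ k"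
    and unipotent: "\<And>x. x \<in> V \<Longrightarrow> (f ^^ (2 ^ e)) x = x" and k: "k \<le> 2 ^ d" and x: "x \<in> V"
  shows "(f ^^ (2 ^ d)) x = x"
proof -
  define N where "N = (\<lambda>x. f x + x)"
  have f0: "f 0 = 0" using f[of 0 0] by simp
  have N_add: "N (x + y) = N x + N y" for x y by (simp add: N_def f add_ac)
  have N0 [simp]: "N 0 = 0" by (simp add: N_def f0)
  have NV: "N x \<in> V" if "x \<in> V" for x using that fV V by (auto simp: N_def)
  have nil: "(N ^^ (2 ^ e)) x = 0" if "x \<in> V" for x
    using additive_funpow_plus_id[of f e x, OF f] unipotent[OF that] by (simp add: N_def)
  have pow_add: "(N ^^ i) (x + y) = (N ^^ i) x + (N ^^ i) y" for i x y
    by (induction i) (simp_all add: N_add)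
  have pow0: "(N ^^ i) 0 = 0" for i by (induction i) simp_all
  have powV: "(N ^^ i) x \<in> V" if "x \<in> V" for i x using that by (induction i) (simp_all add: NV)
  have step: "card ((N ^^ Suc i) ` V) * 2 \<le> card ((N ^^ i) ` V)" if "(N ^^ i) ` V \<noteq> {0}" for i
  proof -
    let ?W = "(N ^^ i) ` V"
    have W_add: "x + y \<in> ?W" if "x \<in> ?W" "y \<in> ?W" for x y
      using that V(2) by (auto simp flip: pow_add)
    have "0 \<in> ?W" using imageI[OF V(1), of "N ^^ i"] pow0[of i] by simp
    then have "\<not> ?W \<subseteq> {0}" using that by (metis empty_subsetI insert_subset subset_antisym)
    then obtain v where v: "v \<in> ?W" "v \<noteq> 0" by auto
    then have "v \<in> V" using powV by auto
    define l where "l = (LEAST l. (N ^^ l) v = 0)"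
    have l: "(N ^^ l) v = 0" unfolding l_def by (rule LeastI) (rule nil[OF \<open>v \<in> V\<close>])
    then obtain m where m: "l = Suc m" using v by (cases l) auto
    define w where "w = (N ^^ m) v"
    have "w \<noteq> 0" using not_less_Least[of m "\<lambda>l. (N ^^ l) v = 0"] m by (simp add: l_def w_def)
    have "N w = 0" using l m by (simp add: w_def)
    have NW: "N x \<in> ?W" if "x \<in> ?W" for x
    proof -
      from that obtain y where "y \<in> V" "x = (N ^^ i) y" by blast
      then have "N x = (N ^^ i) (N y)" by (simp only: funpow_swap1[of N])
      then show ?thesis using NV[OF \<open>y \<in> V\<close>] by blast
    qed
    have "w \<in> ?W" unfolding w_def using v NW by (induction m) auto
    have two: "2 \<le> card {x \<in> ?W. N x = b}" if "b \<in> N ` ?W" for b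
    proof -
      from that obtain x where "x \<in> ?W" "N x = b" by blast
      then have "{x, x + w} \<subseteq> {x \<in> ?W. N x = b}" using W_add \<open>w \<in> ?W\<close> \<open>N w = 0\<close> by (simp add: N_add)
      then have "card {x, x + w} \<le> card {x \<in> ?W. N x = b}" by (intro card_mono) simp_all
      then show ?thesis using \<open>w \<noteq> 0\<close> by simp
    qed
    have "card (N ` ?W) * 2 = (\<Sum>b\<in>N ` ?W. 2)" by simp
    also have "\<dots> \<le> (\<Sum>b\<in>N ` ?W. card {x \<in> ?W. N x = b})" by (rule sum_mono) (rule two)
    also have "\<dots> = card ?W" using sum.image_gen[of ?W "\<lambda>_. 1::nat" N] by simp
    finally show ?thesis by (simp add: image_comp)
  qed
  have "(N ^^ i) ` V = {0} \<or> card ((N ^^ i) ` V) * 2 ^ i \<le> card V" for i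
  proof (induction i)
    case (Suc i)
    then show ?case
    proof (cases "(N ^^ i) ` V = {0}")
      case True
      moreover have "(N ^^ Suc i) ` V = N ` (N ^^ i) ` V" by (simp add: image_comp)
      ultimately have "(N ^^ Suc i) ` V = {0}" by simp
      then show ?thesis by simp
    next
      case False
      have "card ((N ^^ Suc i) ` V) * 2 ^ Suc i = card ((N ^^ Suc i) ` V) * 2 * 2 ^ i" by simp
      also have "\<dots> \<le> card ((N ^^ i) ` V) * 2 ^ i" by (rule mult_right_mono[OF step[OF False]]) simp
      also have "\<dots> \<le> card V" using Suc False by blast
      finally show ?thesis by blast
    qed
  qed simp
  from this[of k] have "(N ^^ k) ` V = {0}"
  proof
    assume "card ((N ^^ k) ` V) * 2 ^ k \<le> card V"
    then have "card ((N ^^ k) ` V) \<le> 1" using V(3) order_trans[of "card ((N ^^ k) ` V) * 2 ^ k" "card V" "1 * 2 ^ k"] by simp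
    moreover have "0 \<in> (N ^^ k) ` V" using V(1) pow0[of k] by (metis imageI)
    moreover have "\<forall>a\<in>(N ^^ k) ` V. \<forall>b\<in>(N ^^ k) ` V. a = b"
      using calculation(1) card_le_Suc0_iff_eq[of "(N ^^ k) ` V"] by (simp only: One_nat_def finite)
    ultimately show ?thesis by blast
  qed
  then have "(N ^^ k) x = 0" using x by auto
  moreover have "(N ^^ 2 ^ d) x = (N ^^ (2 ^ d - k)) ((N ^^ k) x)"
    using k by (metis comp_apply funpow_add le_add_diff_inverse2)
  ultimately have "(N ^^ 2 ^ d) x = 0" by (simp add: pow0)
  then show ?thesis using additive_funpow_plus_id[of f d x, OF f] by (simp add: N_def vec_add_eq_0_iff)
qed

section \<open>Propelinear codes with abelian group\<close>

locale abelian_hfp =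
  fixes C :: "(bit ^ 'n) set" and \<pi> :: "bit ^ 'n \<Rightarrow> 'n \<Rightarrow> 'n"
  assumes hfp: "HFP_code C \<pi>" and abelian: "comm_group (code_group C \<pi>)"
begin

abbreviation G where "G \<equiv> code_group C \<pi>"

definition act where "act x = perm_vec (\<pi> x)"

abbreviation K where "K \<equiv> code_kernel C"

text \<open>
  Its index in the group is the order of the group of linear maps that the code induces on its kernel.
\<close>

definition Stab where "Stab = {x \<in> C. \<forall>y\<in>K. act x y = y}"

lemma hadamard: "hadamard_code C" using hfp by (simp add: HFP_code_def)

lemma zero_in [simp]: "0 \<in> C" using hadamard by (simp add: hadamard_code_def)

lemma compl_in: "x \<in> C \<Longrightarrow> x + 1 \<in> C" using hadamard_code_compl[OF hadamard] .

lemma one_in [simp]: "1 \<in> C" using compl_in[of 0] by simp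

lemma pi_0_1 [simp]: "\<pi> 0 = id" "\<pi> 1 = id" using hfp by (simp_all add: HFP_code_def)

lemma bij_pi: "x \<in> C \<Longrightarrow> bij (\<pi> x)"
  using hfp by (auto simp: HFP_code_def propelinear_def permutes_bij)

lemma G_simps [simp]: "carrier G = C" "x \<otimes>\<^bsub>G\<^esub> y = x + act x y" "\<one>\<^bsub>G\<^esub> = 0"
  by (simp_all add: code_group_def act_def)

sublocale G: comm_group G by (rule abelian)

lemma mult_in: "x \<in> C \<Longrightarrow> y \<in> C \<Longrightarrow> x + act x y \<in> C"
  using G.m_closed[of x y] by simp

lemma mult_commute: "x \<in> C \<Longrightarrow> y \<in> C \<Longrightarrow> x + act x y = y + act y x"
  using G.m_comm[of x y] by simp

lemma pi_mult: "x \<in> C \<Longrightarrow> y \<in> C \<Longrightarrow> \<pi> (x + act x y) = \<pi> x \<circ> \<pi> y"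
  using hfp by (simp add: HFP_code_def propelinear_def act_def)

lemma act_nth: "x \<in> C \<Longrightarrow> act x y $ \<pi> x i = y $ i"
  using bij_pi[of x] by (simp add: act_def perm_vec_def bij_is_inj)

lemma act_add: "act x (y + z) = act x y + act x z" by (simp add: act_def perm_vec_add)

lemma act_const [simp]: "act x 0 = 0" "act x 1 = 1"
  by (simp_all add: act_def perm_vec_def vec_eq_iff)

lemma act_0_1 [simp]: "act 0 y = y" "act 1 y = y"
  by (simp_all add: act_def perm_vec_def vec_eq_iff)

lemma act_mult: "x \<in> C \<Longrightarrow> y \<in> C \<Longrightarrow> act (x + act x y) z = act x (act y z)"
  using pi_mult[of x y] perm_vec_comp[OF bij_pi[of x] bij_pi[of y], of z] by (simp add: act_def)

lemma act_commute: "x \<in> C \<Longrightarrow> y \<in> C \<Longrightarrow> act x (act y z) = act y (act x z)"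
  by (metis act_mult mult_commute)

lemma act_pow: "x \<in> C \<Longrightarrow> act (x [^]\<^bsub>G\<^esub> (m::nat)) y = (act x ^^ m) y"
proof (induction m arbitrary: y)
  case (Suc m)
  have "x [^]\<^bsub>G\<^esub> m \<in> C" using G.nat_pow_closed[of x m] Suc by simp
  then have "act (x [^]\<^bsub>G\<^esub> Suc m) y = act (x [^]\<^bsub>G\<^esub> m) (act x y)" using act_mult Suc.prems by simp
  also have "\<dots> = (act x ^^ m) (act x y)" using Suc.prems by (rule Suc.IH)
  finally show ?case by (simp add: funpow_swap1)
qed simp

lemma pi_pow: "x \<in> C \<Longrightarrow> \<pi> (x [^]\<^bsub>G\<^esub> (m::nat)) = \<pi> x ^^ m"
proof (induction m)
  case (Suc m)
  have "x [^]\<^bsub>G\<^esub> m \<in> C" using G.nat_pow_closed[of x m] Suc by simp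
  then show ?case using Suc by (simp add: pi_mult funpow_Suc_right del: funpow.simps)
qed simp

lemma pow_eq_sum: "x \<in> C \<Longrightarrow> x [^]\<^bsub>G\<^esub> (m::nat) = (\<Sum>j<m. (act x ^^ j) x)"
proof (induction m)
  case (Suc m)
  have "x [^]\<^bsub>G\<^esub> Suc m = x [^]\<^bsub>G\<^esub> m + (act x ^^ m) x" using Suc.prems by (simp add: act_pow)
  also have "\<dots> = (\<Sum>j<Suc m. (act x ^^ j) x)" using Suc by (simp only: sum.lessThan_Suc)
  finally show ?case .
qed simp

lemma pi_add_one: "x \<in> C \<Longrightarrow> \<pi> (x + 1) = \<pi> x"
  using pi_mult[of x 1] by simp

text \<open>
  The coordinate \<open>i\<close> is fixed by the permutation of the quotient of \<open>x\<close> and \<open>y\<close> in the group, so this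
  quotient is a constant word.
\<close>

lemma eq_or_compl_if_pi_eq:
  assumes x: "x \<in> C" and y: "y \<in> C" and eq: "\<pi> x i = \<pi> y i"
  shows "y = x \<or> y = x + 1"
proof -
  define v where "v = inv\<^bsub>G\<^esub> x"
  have v: "v \<in> C" "v + act v x = 0" "x + act x v = 0"
    using G.inv_closed[of x] G.l_inv[of x] G.r_inv[of x] x by (simp_all add: v_def)
  define w where "w = v + act v y"
  have w: "w \<in> C" using v y by (simp add: w_def mult_in)
  have "\<pi> w i = \<pi> v (\<pi> x i)" using v y eq by (simp add: w_def pi_mult)
  also have "\<dots> = i" using pi_mult[OF v(1) x] v by (simp add: fun_eq_iff)
  finally have "w = 0 \<or> w = 1" using hfp w by (auto simp: HFP_code_def)
  moreover have "y = x + act x w"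
    using G.m_assoc[of x v y] x v y by (simp add: w_def)
  ultimately show ?thesis by auto
qed

lemma card_pi_fibre_le: "card {x \<in> C. \<pi> x i = j} \<le> 2"
proof (cases "{x \<in> C. \<pi> x i = j} = {}")
  case False
  then obtain x where x: "x \<in> C" "\<pi> x i = j" by blast
  have "{x \<in> C. \<pi> x i = j} \<subseteq> {x, x + 1}"
  proof
    fix y assume "y \<in> {x \<in> C. \<pi> x i = j}"
    then have "y \<in> C" "\<pi> x i = \<pi> y i" using x by simp_all
    then show "y \<in> {x, x + 1}" using eq_or_compl_if_pi_eq[OF x(1)] by simp
  qed
  then have "card {x \<in> C. \<pi> x i = j} \<le> card {x, x + 1}" by (rule card_mono[rotated]) simp
  also have "\<dots> \<le> 2" by (simp add: card_insert_if)
  finally show ?thesis .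
next
  case True
  then show ?thesis by (simp only: card.empty)
qed

text \<open>
  At most two of the \<open>2n\<close> words send \<open>i\<close> to the same coordinate (\<open>card_pi_fibre_le\<close>), so all \<open>n\<close>
  coordinates are reached.
\<close>

lemma transitive: obtains x where "x \<in> C" "\<pi> x i = j"
proof -
  have "card C \<le> 2 * card ((\<lambda>x. \<pi> x i) ` C)"
    by (rule card_le_fibres) (simp_all add: card_pi_fibre_le)
  then have "CARD('n) \<le> card ((\<lambda>x. \<pi> x i) ` C)" using card_hadamard_code[OF hadamard] by simp
  then have "(\<lambda>x. \<pi> x i) ` C = UNIV" by (intro card_seteq) simp_all
  then show thesis using that by (metis UNIV_I imageE)
qed

lemma card_pi_fibre: "card {x \<in> C. \<pi> x i = j} = 2"
proof -
  obtain x where x: "x \<in> C" "\<pi> x i = j" using transitive .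
  then have "{x, x + 1} \<subseteq> {x \<in> C. \<pi> x i = j}" using compl_in pi_add_one by simp
  then have "card {x, x + 1} \<le> card {x \<in> C. \<pi> x i = j}" by (rule card_mono[rotated]) simp
  moreover have "x \<noteq> x + 1" using add_left_cancel[of x 0 1] by (metis add.right_neutral vec_eq_iff one_index zero_index zero_neq_one)
  ultimately show ?thesis using card_pi_fibre_le[of i j] by simp
qed

lemma kernel_add_in: "x \<in> C \<Longrightarrow> z \<in> K \<Longrightarrow> x + z \<in> C"
  by (auto simp: code_kernel_def)

lemma kernelI:
  assumes "\<And>x. x \<in> C \<Longrightarrow> x + z \<in> C"
  shows "z \<in> K"
proof -
  have "C \<subseteq> (\<lambda>x. x + z) ` C" using assms by (metis (no_types, lifting) image_eqI subsetI vec_add_cancel2)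
  then show ?thesis using assms by (auto simp: code_kernel_def)
qed

lemma kernel_subset: "K \<subseteq> C" by (rule code_kernel_subset) simp

lemma kernel_in: "z \<in> K \<Longrightarrow> z \<in> C" using kernel_subset by blast

lemma kernel_add: "y \<in> K \<Longrightarrow> z \<in> K \<Longrightarrow> y + z \<in> K"
  using subspace_code_kernel by (rule vec.subspace_add)

lemma zero_in_kernel [simp]: "0 \<in> K" by (rule kernelI) simp

lemma one_in_kernel [simp]: "1 \<in> K" by (rule kernelI) (rule compl_in)

text \<open>
  Every word \<open>c\<close> has the form \<open>x * d\<close>, and \<open>x * d + \<pi>\<^sub>x(z) = x * (d + z)\<close>.
\<close>

lemma act_kernel:
  assumes x: "x \<in> C" and z: "z \<in> K"
  shows "act x z \<in> K"
proof (rule kernelI)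
  fix c assume c: "c \<in> C"
  define v where "v = inv\<^bsub>G\<^esub> x"
  have v: "v \<in> C" "x + act x v = 0" using G.inv_closed[of x] G.r_inv[of x] x by (simp_all add: v_def)
  define d where "d = v + act v c"
  have d: "d \<in> C" using v c by (simp add: d_def mult_in)
  have "c = x + act x d" using G.m_assoc[of x v c] x v c by (simp add: d_def)
  then have "c + act x z = x + act x (d + z)" by (simp add: act_add add.assoc)
  then show "c + act x z \<in> C" using x z d by (simp add: mult_in kernel_add_in)
qed

lemma subgroup_kernel: "subgroup K G"
proof (rule G.subgroupI)
  fix x assume x: "x \<in> K"
  define w where "w = inv\<^bsub>G\<^esub> x"
  have "w \<in> C" "w + act w x = 0"
    using G.inv_closed[of x] G.l_inv[of x] kernel_in[OF x] by (simp_all add: w_def)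
  then show "inv\<^bsub>G\<^esub> x \<in> K" using act_kernel[OF _ x] by (metis vec_add_eq_0_iff w_def)
next
  show "K \<noteq> {}" using zero_in_kernel by (metis empty_iff)
qed (use kernel_subset in \<open>auto simp: kernel_add act_kernel kernel_in\<close>)

lemma Stab_in: "x \<in> Stab \<Longrightarrow> x \<in> C" by (simp add: Stab_def)

lemma Stab_act: "x \<in> Stab \<Longrightarrow> y \<in> K \<Longrightarrow> act x y = y" by (simp add: Stab_def)

lemma subgroup_Stab: "subgroup Stab G"
proof (rule G.subgroupI)
  fix x assume x: "x \<in> Stab"
  define w where "w = inv\<^bsub>G\<^esub> x"
  have w: "w \<in> C" "w + act w x = 0"
    using G.inv_closed[of x] G.l_inv[of x] Stab_in[OF x] by (simp_all add: w_def)
  have "act w y = y" if "y \<in> K" for y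
    using act_mult[OF w(1) Stab_in[OF x], of y] Stab_act[OF x that] w by simp
  then show "inv\<^bsub>G\<^esub> x \<in> Stab" using w by (simp add: Stab_def w_def)
qed (auto simp: Stab_def mult_in act_mult intro: zero_in)

lemma one_in_Stab [simp]: "1 \<in> Stab" by (simp add: Stab_def)

text \<open>
  Commutativity of the group turns a trivial action of \<open>x\<close> on \<open>y\<close> into a trivial action of \<open>y\<close> on \<open>x\<close>.
\<close>

lemma kernel_act: "x \<in> Stab \<Longrightarrow> y \<in> K \<Longrightarrow> act y x = x"
  using mult_commute[of x y] by (simp add: Stab_act Stab_in kernel_in add.commute)

text \<open>
  Fix a coordinate \<open>i\<close> and let \<open>L\<close> consist of the coordinates that agree with \<open>i\<close> on all words of \<open>K\<close>.
  Summing the signs of \<open>y\<^sub>i y\<^sub>j\<close> over all \<open>y \<in> K\<close> and all \<open>j\<close> gives \<open>2n\<close> one way, as only the constant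
  words are not balanced, and \<open>|L| |K|\<close> the other way, by orthogonality of characters of \<open>K\<close>. A word
  belongs to \<open>Stab\<close> iff it moves \<open>i\<close> into \<open>L\<close>: all coordinates are images of \<open>i\<close> under the
  commutative group, so agreement at \<open>i\<close> propagates to all of them. Since each place is the image of
  \<open>i\<close> under two words, \<open>|Stab| = 2 |L|\<close>.
\<close>

lemma card_Stab_mult_card_kernel: "card Stab * card K = 2 * card C"
proof -
  fix i :: 'n
  define L where "L = {j. \<forall>y\<in>K. y $ j = y $ i}"
  have "(\<Sum>y\<in>K. \<Sum>j\<in>UNIV. bsign (y $ i) * bsign (y $ j)) = (\<Sum>y\<in>K. if y \<in> {0, 1} then int CARD('n) else 0)"
  proof (rule sum.cong)
    fix y assume y: "y \<in> K"
    show "(\<Sum>j\<in>UNIV. bsign (y $ i) * bsign (y $ j)) = (if y \<in> {0, 1} then int CARD('n) else 0)"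
    proof (cases "y \<in> {0, 1}")
      case False
      then have "(\<Sum>j\<in>UNIV. bsign (y $ j) * bsign ((0 :: bit ^ 'n) $ j)) = 0"
        using hadamard_code_orthogonal[OF hadamard kernel_in[OF y] zero_in] by simp
      then show ?thesis using False by (simp flip: sum_distrib_left)
    qed auto
  qed simp
  also have "\<dots> = (\<Sum>y\<in>{0, 1 :: bit ^ 'n}. int CARD('n))"
    by (rule sum.mono_neutral_cong_right) auto
  also have "\<dots> = 2 * int CARD('n)" by (simp add: vec_eq_iff)
  finally have "(\<Sum>j\<in>UNIV. \<Sum>y\<in>K. bsign (y $ i) * bsign (y $ j)) = 2 * int CARD('n)"
    by (subst sum.swap)
  moreover have "(\<Sum>y\<in>K. bsign (y $ i) * bsign (y $ j)) = (if j \<in> L then int (card K) else 0)" for j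
  proof (cases "j \<in> L")
    case True
    then show ?thesis by (simp add: L_def)
  next
    case False
    then obtain w where w: "w \<in> K" "w $ j \<noteq> w $ i" by (auto simp: L_def)
    then have ws: "bsign (w $ i) * bsign (w $ j) = -1" by (cases "w $ i"; cases "w $ j") auto
    have "(\<Sum>y\<in>K. bsign (y $ i) * bsign (y $ j)) = (\<Sum>y\<in>K. bsign ((y + w) $ i) * bsign ((y + w) $ j))"
      by (rule sum.reindex_bij_witness[of _ "\<lambda>y. y + w" "\<lambda>y. y + w"]) (simp_all add: w kernel_add del: vector_add_component)
    also have "\<dots> = (\<Sum>y\<in>K. (bsign (w $ i) * bsign (w $ j)) * (bsign (y $ i) * bsign (y $ j)))"
      by (rule sum.cong) (simp_all add: bsign_add mult_ac del: add_bit_eq_xor)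
    also have "\<dots> = - (\<Sum>y\<in>K. bsign (y $ i) * bsign (y $ j))" by (simp add: ws sum_negf)
    finally show ?thesis using False by simp
  qed
  ultimately have "int (card L * card K) = int (2 * CARD('n))"
    by (simp add: sum.If_cases)
  then have L: "card L * card K = 2 * CARD('n)" by (simp only: of_nat_eq_iff)
  have Stab_eq: "Stab = {x \<in> C. \<pi> x i \<in> L}"
  proof (intro equalityI subsetI)
    fix x assume x: "x \<in> Stab"
    have "y $ \<pi> x i = y $ i" if "y \<in> K" for y
      using act_nth[OF Stab_in[OF x], of y i] Stab_act[OF x that] by simp
    then show "x \<in> {x \<in> C. \<pi> x i \<in> L}" using Stab_in[OF x] by (simp add: L_def)
  next
    fix x assume "x \<in> {x \<in> C. \<pi> x i \<in> L}"
    then have x: "x \<in> C" and xL: "\<And>y. y \<in> K \<Longrightarrow> y $ \<pi> x i = y $ i" by (auto simp: L_def)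
    have "act x y = y" if y: "y \<in> K" for y
    proof -
      have "act x y $ j = y $ j" for j
      proof -
        obtain w where w: "w \<in> C" "\<pi> w (\<pi> x i) = j" using transitive .
        define v where "v = inv\<^bsub>G\<^esub> w"
        have v: "v \<in> C" "w + act w v = 0" using G.inv_closed[of w] G.r_inv[of w] w by (simp_all add: v_def)
        define y' where "y' = act v y"
        have y': "y' \<in> K" using act_kernel v y by (simp add: y'_def)
        have y_eq: "y = act w y'" using act_mult[OF w(1) v(1), of y] v by (simp add: y'_def)
        have "act x y $ j = act w (act x y') $ \<pi> w (\<pi> x i)" using w x by (simp add: y_eq act_commute)
        also have "\<dots> = y' $ i" using act_nth[OF w(1), of "act x y'" "\<pi> x i"] act_nth[OF x, of y' i] by simp
        also have "\<dots> = y $ j" using xL[OF y'] w by (simp add: y_eq act_nth flip: w(2))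
        finally show ?thesis .
      qed
      then show ?thesis by (simp add: vec_eq_iff)
    qed
    then show "x \<in> Stab" using x by (simp add: Stab_def)
  qed
  have "card Stab = (\<Sum>j\<in>(\<lambda>x. \<pi> x i) ` Stab. card {x \<in> Stab. \<pi> x i = j})"
    using sum.image_gen[of Stab "\<lambda>_. 1::nat" "\<lambda>x. \<pi> x i"] by simp
  also have "(\<lambda>x. \<pi> x i) ` Stab = L" unfolding Stab_eq using transitive[of i] by (auto simp: image_iff) metis
  also have "(\<Sum>j\<in>L. card {x \<in> Stab. \<pi> x i = j}) = (\<Sum>j\<in>L. 2)"
  proof (rule sum.cong)
    fix j assume "j \<in> L"
    then have "{x \<in> Stab. \<pi> x i = j} = {x \<in> C. \<pi> x i = j}" by (auto simp: Stab_eq)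
    then show "card {x \<in> Stab. \<pi> x i = j} = 2" by (simp add: card_pi_fibre)
  qed simp
  finally show ?thesis using L card_hadamard_code[OF hadamard] by simp
qed

text \<open>
  If \<open>C\<close> were the union of \<open>K\<close> and one further coset \<open>x + K\<close>, then translation by \<open>x\<close> would swap
  the two, and \<open>x\<close> would lie in \<open>K\<close>.
\<close>

lemma kernel_eq_if_card_le:
  assumes "card C \<le> 2 * card K"
  shows "K = C"
proof (rule ccontr)
  assume "K \<noteq> C"
  then obtain x where x: "x \<in> C" "x \<notin> K" using kernel_subset by blast
  have sub: "(\<lambda>z. x + z) ` K \<subseteq> C" using kernel_add_in[OF x(1)] by blast
  have disj: "K \<inter> (\<lambda>z. x + z) ` K = {}"
  proof (rule ccontr)
    assume "K \<inter> (\<lambda>z. x + z) ` K \<noteq> {}"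
    then obtain z where "z \<in> K" "x + z \<in> K" by blast
    then have "(x + z) + z \<in> K" by (rule kernel_add[rotated])
    then show False using x by simp
  qed
  have "card ((\<lambda>z. x + z) ` K) = card K" by (rule card_image) (simp add: inj_on_def)
  then have "card (K \<union> (\<lambda>z. x + z) ` K) = 2 * card K" using disj by (simp add: card_Un_disjoint)
  then have C: "C = K \<union> (\<lambda>z. x + z) ` K"
    using assms sub kernel_subset by (intro card_seteq[symmetric]) simp_all
  have "x \<in> K"
  proof (rule kernelI)
    fix y assume "y \<in> C"
    then consider "y \<in> K" | z where "z \<in> K" "y = x + z" using C by blast
    then show "y + x \<in> C"
    proof cases
      case 1 then show ?thesis using kernel_add_in[OF x(1) 1] by (simp add: add.commute)
    next
      case 2
      then have "y + x = z" by (metis add.commute add.left_commute vec_add_cancel2)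
      then show ?thesis using 2 kernel_in by simp
    qed
  qed
  then show False using x by simp
qed

text \<open>
  The index of \<open>Stab\<close> is a power of 2, so \<open>x\<close> acts on \<open>K\<close> with 2-power order, that is, unipotently.
\<close>

lemma pow_in_Stab:
  assumes K: "card K = 2 ^ k" "k \<le> 2 ^ d" and x: "x \<in> C"
  shows "x [^]\<^bsub>G\<^esub> (2 ^ d :: nat) \<in> Stab"
proof -
  have "card {0 :: bit ^ 'n, 1} \<le> card K" by (rule card_mono) simp_all
  moreover have "(0 :: bit ^ 'n) \<noteq> 1" by (simp add: vec_eq_iff)
  ultimately obtain e where e: "k = Suc e" using K by (cases k) auto
  have "order G = 2 ^ e * card Stab"
    using card_Stab_mult_card_kernel K by (simp add: order_def e mult.commute)
  then have in_S: "x [^]\<^bsub>G\<^esub> (2 ^ e :: nat) \<in> Stab" if "x \<in> C" for x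
    using G.pow_index_mem_subgroup[OF _ subgroup_Stab] that by simp
  have "(act x ^^ (2 ^ d)) y = y" if y: "y \<in> K" for y
  proof (rule unipotent_funpow_eq_id[where V = K and k = k and e = e])
    fix y assume "y \<in> K"
    then show "(act x ^^ 2 ^ e) y = y" using in_S[OF x] Stab_act by (simp add: act_pow[OF x, symmetric])
  qed (use K x y in \<open>auto simp: act_add act_kernel kernel_add\<close>)
  then show ?thesis using G.nat_pow_closed[of x] x by (simp add: Stab_def act_pow)
qed

lemma subgroup_0_1: "subgroup {0, 1} G"
  by (rule G.subgroupI) (auto intro: G.inv_equality)

end

section \<open>Codes whose kernel stabiliser is cyclic modulo the constant words\<close>

context abelian_hfp
begin

lemma sum_bsign_orthogonal:
  assumes "x \<in> C" "y \<in> C" "x \<noteq> y" "x \<noteq> y + 1"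
  shows "(\<Sum>i\<in>UNIV. bsign (x $ i) * bsign (y $ i)) = 0"
  using hadamard_code_orthogonal[OF hadamard] assms by blast

text \<open>
  With \<open>z = c^m\<close> the first power of \<open>c\<close> in the kernel, the word \<open>z\<close> is constant and \<open>m\<close> is even, and
  \<open>c^(m/2)\<close> is the required element. The proof studies the sum \<open>T\<close> of the signs of the translates
  \<open>v j\<close> of \<open>c\<close>, whose sum over the binary field is \<open>z\<close>.
\<close>

lemma cyclic_stabiliser_half_power:
  assumes nonlinear: "K \<noteq> C" and c: "c \<in> Stab"
    and gen: "\<And>x. x \<in> Stab \<Longrightarrow> \<exists>i::nat. \<exists>\<beta>\<in>{0, 1}. x = c [^]\<^bsub>G\<^esub> i \<otimes>\<^bsub>G\<^esub> \<beta>"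
  obtains z where "z \<in> Stab" "z \<notin> K" "z \<otimes>\<^bsub>G\<^esub> z \<in> {0, 1}" "Stab \<inter> K = {0, 1}"
proof -
  note subU = subgroup_0_1 and subK = subgroup_kernel and subS = subgroup_Stab
  have cC: "c \<in> C" using c by (rule Stab_in)
  have cpowS: "c [^]\<^bsub>G\<^esub> j \<in> Stab" for j :: nat by (rule G.subgroup_nat_pow_closed[OF subS c])
  note cpowC = cpowS[THEN Stab_in]
  define m where "m = (LEAST m::nat. 0 < m \<and> c [^]\<^bsub>G\<^esub> m \<in> K)"
  have "0 < order G \<and> c [^]\<^bsub>G\<^esub> order G \<in> K"
    using cC G.pow_order_eq_1[of c] by (simp add: G.order_gt_0_iff_finite del: G.pow_order_eq_1)
  then have m: "0 < m" "c [^]\<^bsub>G\<^esub> m \<in> K"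
    unfolding m_def using LeastI[of "\<lambda>m::nat. 0 < m \<and> c [^]\<^bsub>G\<^esub> m \<in> K"] by blast+
  have m_least: "c [^]\<^bsub>G\<^esub> i \<notin> K" if "0 < i" "i < m" for i
    using that not_less_Least[of i "\<lambda>m::nat. 0 < m \<and> c [^]\<^bsub>G\<^esub> m \<in> K"] by (auto simp: m_def[symmetric])
  define z where "z = c [^]\<^bsub>G\<^esub> m"
  have z: "z \<in> K" "z \<in> Stab" "z \<in> C" using m cpowS cpowC by (simp_all add: z_def)
  \<comment> \<open>\<open>Stab\<close> fixes \<open>z\<close> because \<open>z \<in> K\<close>, and \<open>K\<close> fixes \<open>z\<close> because \<open>z \<in> Stab\<close>.\<close>
  have act_z: "act x z = z" if "x \<in> Stab \<or> x \<in> K" for x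
    using that Stab_act[OF _ z(1)] kernel_act[OF z(2)] by blast
  have zz: "z \<otimes>\<^bsub>G\<^esub> z = 0" using act_z z by simp

  \<comment> \<open>An exponent \<open>i\<close> with \<open>c^i \<in> K\<close> is a multiple of \<open>m\<close>, hence \<open>Stab \<inter> K = \<langle>z\<rangle> U\<close> has at most 4 elements.\<close>
  have gen_SK: "\<exists>i::nat. \<exists>\<beta>\<in>{0, 1}. x = z [^]\<^bsub>G\<^esub> i \<otimes>\<^bsub>G\<^esub> \<beta>" if x: "x \<in> Stab \<inter> K" for x
  proof -
    obtain i :: nat and \<beta> where \<beta>: "\<beta> \<in> {0, 1}" and xi: "x = c [^]\<^bsub>G\<^esub> i \<otimes>\<^bsub>G\<^esub> \<beta>"
      using gen x by blast
    have "c [^]\<^bsub>G\<^esub> i = x + \<beta>" using \<beta> xi by auto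
    then have "c [^]\<^bsub>G\<^esub> i \<in> K" using x \<beta> kernel_add by auto
    moreover have i: "c [^]\<^bsub>G\<^esub> i = c [^]\<^bsub>G\<^esub> (i mod m) \<otimes>\<^bsub>G\<^esub> z [^]\<^bsub>G\<^esub> (i div m)"
      using cC by (simp only: z_def G.nat_pow_pow G.nat_pow_mult G_simps(1) mod_mult_div_eq)
    moreover have "z [^]\<^bsub>G\<^esub> (i div m) \<in> K" using G.subgroup_nat_pow_closed[OF subK z(1)] .
    ultimately have "c [^]\<^bsub>G\<^esub> (i mod m) \<otimes>\<^bsub>G\<^esub> z [^]\<^bsub>G\<^esub> (i div m) \<in> K" by (simp only:)
    then have "c [^]\<^bsub>G\<^esub> (i mod m) \<in> K"
      by (rule G.subgroup_mult_cancel_right[OF subK]) (use cpowC G.subgroup_nat_pow_closed[OF subK z(1)] in simp_all)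
    then have "i mod m = 0" using m_least[of "i mod m"] m by (cases "i mod m = 0") auto
    then have "c [^]\<^bsub>G\<^esub> i = z [^]\<^bsub>G\<^esub> (i div m)"
      using i G.subgroup_nat_pow_closed[OF subK z(1), THEN kernel_in, of "i div m"] by (simp del: G_simps(2))
    then show ?thesis using xi \<beta> by auto
  qed
  have card_le: "card (Stab \<inter> K) \<le> M * 2" if "0 < M" "z [^]\<^bsub>G\<^esub> M \<in> {0, 1}" for M :: nat
  proof -
    have "card (Stab \<inter> K) \<le> M * card {0 :: bit ^ 'n, 1}"
      by (rule G.card_cyclic_extension_le[OF subU _ _ that]) (simp, simp add: z, erule gen_SK)
    then show ?thesis by (simp add: card_insert_if)
  qed
  have card4: "card (Stab \<inter> K) \<le> 4" using card_le[of 2] zz z by (simp add: numeral_2_eq_2)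
  have card2: "card (Stab \<inter> K) \<le> 2" if "z \<in> {0, 1}" using card_le[of 1] that z by simp
  \<comment> \<open>Otherwise \<open>Stab\<close> has at most 4 elements, which leaves room for at most two cosets of \<open>K\<close> in \<open>C\<close>.\<close>
  have "c \<notin> K"
  proof
    assume "c \<in> K"
    have "Stab \<subseteq> K"
    proof
      fix x assume "x \<in> Stab"
      then obtain i :: nat and \<beta> where "\<beta> \<in> {0, 1}" "x = c [^]\<^bsub>G\<^esub> i \<otimes>\<^bsub>G\<^esub> \<beta>" using gen by blast
      moreover have "c [^]\<^bsub>G\<^esub> i \<in> K" by (rule G.subgroup_nat_pow_closed[OF subK \<open>c \<in> K\<close>])
      ultimately show "x \<in> K" by (auto intro: kernel_add)
    qed
    then have "card Stab \<le> 4" using card4 by (simp add: Int_absorb2)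
    then have "2 * card C \<le> 4 * card K" using card_Stab_mult_card_kernel by (metis mult_le_mono1)
    then show False using kernel_eq_if_card_le nonlinear by simp
  qed

  define v where "v j = (act c ^^ j) c" for j
  have v_eq: "v j = act (c [^]\<^bsub>G\<^esub> j) c" for j using cC by (simp add: v_def act_pow)
  define T where "T i = (\<Sum>j<m. bsign (v j $ i))" for i
  have T_kernel: "T (\<pi> y i) = T i" if y: "y \<in> K" for y i
  proof -
    have "act y (v j) = v j" for j
      using kernel_act[OF c y] act_commute[OF kernel_in[OF y] cpowC] by (simp add: v_eq)
    then have "v j $ \<pi> y i = v j $ i" for j using act_nth[OF kernel_in[OF y], of "v j" i] by simp
    then show ?thesis by (simp add: T_def)
  qed
  have T_c: "T (\<pi> c i) = T i" for i
  proof -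
    \<comment> \<open>The permutation \<open>\<pi>\<^sub>c\<close> shifts the translates, and the window of length \<open>m\<close> closes up since \<open>z\<close> fixes \<open>c\<close>.\<close>
    have v_m: "v m = v 0" using kernel_act[OF c z(1)] by (simp add: v_eq flip: z_def)
    have "v (Suc j) $ \<pi> c i = v j $ i" for j
      using act_nth[OF cC, of "v j" i] by (simp add: v_def)
    then have "T i + bsign (v 0 $ \<pi> c i) = (\<Sum>j<Suc m. bsign (v j $ \<pi> c i))"
      unfolding sum.lessThan_Suc_shift T_def by (simp only: add.commute)
    also have "\<dots> = T (\<pi> c i) + bsign (v 0 $ \<pi> c i)" by (simp only: sum.lessThan_Suc v_m T_def)
    finally show ?thesis by (simp only: add_right_cancel)
  qed
  have T_S: "T (\<pi> x i) = T i" if "x \<in> Stab" for x i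
  proof -
    obtain j :: nat and \<beta> where \<beta>: "\<beta> \<in> {0, 1}" and xj: "x = c [^]\<^bsub>G\<^esub> j \<otimes>\<^bsub>G\<^esub> \<beta>"
      using gen[OF \<open>x \<in> Stab\<close>] by blast
    have "\<pi> x = \<pi> c ^^ j" using \<beta> cpowC[of j] cC by (auto simp: xj pi_add_one pi_pow)
    moreover have "T ((\<pi> c ^^ j) i) = T i" by (induction j) (simp_all add: T_c)
    ultimately show ?thesis by simp
  qed

  \<comment> \<open>The orbit of \<open>i\<close> under \<open>Stab * K\<close> lies in the level set \<open>L\<close> of \<open>z\<close>; counting shows that it is all of \<open>L\<close>.\<close>
  have T_level: "T j = T i" if "z $ j = z $ i" for i j
  proof -
    define L where "L = {j. z $ j = z $ i}"
    define P where "P = (\<lambda>(x, y). x \<otimes>\<^bsub>G\<^esub> y) ` (Stab \<times> K)"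
    define Orb where "Orb = (\<lambda>p. \<pi> p i) ` P"
    have P: "p \<in> C \<and> \<pi> p i \<in> L \<and> T (\<pi> p i) = T i" if "p \<in> P" for p
    proof -
      obtain x y where xy: "x \<in> Stab" "y \<in> K" "p = x + act x y" using \<open>p \<in> P\<close> by (auto simp: P_def)
      have p: "p \<in> C" "\<pi> p i = \<pi> x (\<pi> y i)"
        using xy Stab_in kernel_in by (simp_all add: mult_in pi_mult)
      have "z $ \<pi> x (\<pi> y i) = z $ i"
        using act_nth[OF Stab_in[OF xy(1)], of z "\<pi> y i"] act_nth[OF kernel_in[OF xy(2)], of z i] act_z xy by simp
      then show ?thesis using p T_S[OF xy(1)] T_kernel[OF xy(2)] by (simp add: L_def)
    qed
    have "4 * CARD('n) = card Stab * card K"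
      using card_Stab_mult_card_kernel card_hadamard_code[OF hadamard] by simp
    also have "\<dots> \<le> card (Stab \<inter> K) * card P"
      unfolding P_def by (rule G.card_subgroup_mult_le[OF _ subS subK]) simp
    also have "card P \<le> 2 * card Orb" unfolding Orb_def
    proof (rule card_le_fibres)
      fix b
      have "card {p \<in> P. \<pi> p i = b} \<le> card {x \<in> C. \<pi> x i = b}" using P by (intro card_mono) auto
      also have "\<dots> \<le> 2" by (rule card_pi_fibre_le)
      finally show "card {p \<in> P. \<pi> p i = b} \<le> 2" .
    qed simp
    finally have Orb: "2 * CARD('n) \<le> card (Stab \<inter> K) * card Orb" by (simp add: mult.commute)
    have "card L \<le> card Orb"
    proof (cases "z \<in> {0, 1}")
      case True
      have "2 * CARD('n) \<le> 2 * card Orb" using Orb card2[OF True] by (meson le_trans mult_le_mono1)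
      moreover have "card L \<le> CARD('n)" by (rule card_mono) simp_all
      ultimately show ?thesis by simp
    next
      case False
      have "2 * CARD('n) \<le> 4 * card Orb" using Orb card4 by (meson le_trans mult_le_mono1)
      moreover have "2 * card L = CARD('n)"
      proof -
        have "(\<Sum>j\<in>UNIV. bsign (z $ j) * bsign (z $ i)) = 0"
          using sum_bsign_orthogonal[of z 0] z False by (simp flip: sum_distrib_right)
        moreover have "bsign (z $ j) * bsign (z $ i) = (if j \<in> L then 1 else -1)" for j
          by (cases "z $ j"; cases "z $ i") (auto simp: L_def)
        ultimately have "int (card L) - int (card (- L)) = 0" by (simp add: sum.If_cases)
        moreover have "card L + card (- L) = CARD('n)"
          by (subst card_Un_disjoint[symmetric]) (simp_all add: Compl_partition)
        ultimately show ?thesis by simp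
      qed
      ultimately show ?thesis by simp
    qed
    moreover have "Orb \<subseteq> L" using P by (auto simp: Orb_def)
    ultimately have "Orb = L" by (intro card_seteq) simp_all
    then have "j \<in> Orb" using that by (simp add: L_def)
    then show ?thesis using P by (auto simp: Orb_def)
  qed

  have T_sum: "(\<Sum>i\<in>UNIV. bsign (w $ i) * T i) = 0" if w: "w \<in> Stab \<inter> K" for w
  proof -
    have "(\<Sum>i\<in>UNIV. bsign (w $ i) * bsign (v j $ i)) = 0" for j
    proof -
      let ?p = "\<pi> (c [^]\<^bsub>G\<^esub> j)"
      have "(\<Sum>i\<in>UNIV. bsign (w $ i) * bsign (v j $ i)) = (\<Sum>i\<in>UNIV. bsign (w $ ?p i) * bsign (v j $ ?p i))"
        by (rule sum.reindex_bij_betw[symmetric]) (rule bij_pi[OF cpowC])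
      also have "\<dots> = (\<Sum>i\<in>UNIV. bsign (w $ i) * bsign (c $ i))"
        using act_nth[OF cpowC, of j w] act_nth[OF cpowC, of j c] Stab_act[OF cpowS] w by (simp add: v_eq)
      also have "\<dots> = 0"
        by (rule sum_bsign_orthogonal) (use w \<open>c \<notin> K\<close> kernel_in cC kernel_add[of w 1] in auto)
      finally show ?thesis .
    qed
    moreover have "(\<Sum>i\<in>UNIV. bsign (w $ i) * T i) = (\<Sum>j<m. \<Sum>i\<in>UNIV. bsign (w $ i) * bsign (v j $ i))"
      unfolding T_def sum_distrib_left by (rule sum.swap)
    ultimately show ?thesis by simp
  qed
  \<comment> \<open>With \<open>s\<close> the signs of \<open>z\<close>, \<open>1 + s\<^sub>i s\<^sub>j\<close> is, in \<open>j\<close>, twice the indicator of the level set of \<open>i\<close>.\<close>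
  have T_0: "T i = 0" for i
  proof -
    have "0 = (\<Sum>j\<in>UNIV. bsign (0 $ j) * T j) + bsign (z $ i) * (\<Sum>j\<in>UNIV. bsign (z $ j) * T j)"
      using T_sum[of z] T_sum[of 0] z subgroup.one_closed[OF subS] by simp
    also have "\<dots> = (\<Sum>j\<in>UNIV. (1 + bsign (z $ i) * bsign (z $ j)) * T j)"
      by (simp add: sum_distrib_left sum.distrib algebra_simps)
    also have "\<dots> = (\<Sum>j\<in>UNIV. (1 + bsign (z $ i) * bsign (z $ j)) * T i)"
    proof (rule sum.cong)
      fix j
      show "(1 + bsign (z $ i) * bsign (z $ j)) * T j = (1 + bsign (z $ i) * bsign (z $ j)) * T i"
        using T_level[of j i] by (cases "z $ i"; cases "z $ j") auto
    qed simp
    also have "\<dots> = (\<Sum>j\<in>UNIV. 1 + bsign (z $ i) * bsign (z $ j)) * T i" by (rule sum_distrib_right[symmetric])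
    finally have "(\<Sum>j\<in>UNIV. 1 + bsign (z $ i) * bsign (z $ j)) * T i = 0" by simp
    moreover have "0 < (\<Sum>j\<in>UNIV. 1 + bsign (z $ i) * bsign (z $ j))"
      by (rule sum_pos2[of _ i]) (auto simp: bsign_def)
    ultimately show ?thesis by simp
  qed
  have count: "m = 2 * card {j \<in> {..<m}. v j $ i = 1}" for i
    using T_0[of i] sum_bsign[of "{..<m}" "\<lambda>j. v j $ i"] by (simp add: T_def)
  then have "even m" by (metis dvd_triv_left)
  then obtain h where h: "m = 2 * h" by (elim evenE)
  have "z $ i = (if odd h then 1 else 0)" for i
  proof -
    have "z $ i = (\<Sum>j<m. v j $ i)" using pow_eq_sum[OF cC, of m] by (simp add: z_def v_def)
    moreover have "card {j \<in> {..<m}. v j $ i = 1} = h" using count[of i] h by simp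
    ultimately show ?thesis using sum_bit_eq_1_iff[of "{..<m}" "\<lambda>j. v j $ i"] by (cases "z $ i") auto
  qed
  then have zU: "z \<in> {0, 1}" by (cases "odd h") (auto simp: vec_eq_iff)
  have "{0, 1} \<subseteq> Stab \<inter> K" using subgroup.one_closed[OF subS] by simp
  moreover have "card {0 :: bit ^ 'n, 1} = 2" by (simp add: vec_eq_iff)
  ultimately have SK: "Stab \<inter> K = {0, 1}" using card2[OF zU] by (metis card_seteq finite)
  define z' where "z' = c [^]\<^bsub>G\<^esub> h"
  have "z' \<notin> K" using m_least[of h] m h by (simp add: z'_def)
  moreover have "z' \<otimes>\<^bsub>G\<^esub> z' = z" using cC h G.nat_pow_mult[of c h h] by (simp add: z'_def z_def mult_2)
  ultimately show thesis using that[of z'] cpowS[of h] zU SK by (simp add: z'_def)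
qed

end

section \<open>The bound for groups with two generators\<close>

text \<open>
  The common core of the three types: the constant word \<open>1\<close> is a power of \<open>a\<close> or of \<open>b\<close> in two of
  them, and it generates a direct factor of its own in the third.
\<close>

locale abelian_hfp_two_generated = abelian_hfp C \<pi>
  for C :: "(bit ^ 'n) set" and \<pi> :: "bit ^ 'n \<Rightarrow> 'n \<Rightarrow> 'n" +
  fixes a b :: "bit ^ 'n"
  assumes a_in: "a \<in> C" and b_in: "b \<in> C" and b_square: "b \<otimes>\<^bsub>G\<^esub> b \<in> {0, 1}"
    and generating: "\<And>x. x \<in> C \<Longrightarrow>
      \<exists>(i::nat) (j::nat) (l::nat). x = a [^]\<^bsub>G\<^esub> i \<otimes>\<^bsub>G\<^esub> b [^]\<^bsub>G\<^esub> j \<otimes>\<^bsub>G\<^esub> 1 [^]\<^bsub>G\<^esub> l"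
begin

abbreviation B where "B \<equiv> {0, 1, b, b + 1}"

lemma subgroup_B: "subgroup B G"
proof -
  have act_b1: "act (b + 1) = act b" by (simp add: act_def pi_add_one[OF b_in] fun_eq_iff)
  have cancel: "1 + b = b + 1" "1 + (b + 1) = b" "b + (b + 1) = 1" "b + 1 + b = 1" "b + (1 + b) = 1"
    by (metis add.commute add.left_commute vec_add_cancel2)+
  have closed: "x + act x y \<in> B" if "x \<in> B" "y \<in> B" for x y
  proof -
    consider "act b b = b" | "act b b = b + 1" using b_square
      by (auto simp: vec_add_eq_0_iff) (metis add.commute vec_add_cancel2)
    then show ?thesis using that by cases (auto simp: act_b1 act_add cancel)
  qed
  show ?thesis
  proof (rule G.subgroupI)
    fix x assume x: "x \<in> B"
    have xC: "x \<in> C" using x b_in compl_in by auto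
    have sq: "b + 1 + (act b b + 1) = b + act b b" "1 + 1 = (0 :: bit ^ 'n)" "2 = (0 :: bit ^ 'n)"
      by (metis add.commute add.left_commute vec_add_cancel2, simp, metis one_add_one bit_vec_add_self)
    have xx: "x + act x x \<in> {0, 1}"
      using x b_square by (auto simp: act_b1 act_add sq)
    show "inv\<^bsub>G\<^esub> x \<in> B"
    proof (cases "x + act x x = 0")
      case True
      then have "inv\<^bsub>G\<^esub> x = x" using xC by (intro G.inv_equality) simp_all
      then show ?thesis using x by simp
    next
      case False
      then have "x + act x x = 1" using xx by simp
      then have "x + act x (x + 1) = 0" by (simp add: act_add flip: add.assoc)
      then have "inv\<^bsub>G\<^esub> x = x + 1" 
        using xC compl_in G.m_comm[of x "x + 1"] by (intro G.inv_equality) simp_all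
      then show ?thesis using x cancel by auto
    qed
  next
    fix x y assume "x \<in> B" "y \<in> B"
    then show "x \<otimes>\<^bsub>G\<^esub> y \<in> B" using closed by simp
  qed (use b_in compl_in in auto)
qed

lemma generated:
  assumes "x \<in> C"
  shows "\<exists>i::nat. \<exists>\<beta>\<in>B. x = a [^]\<^bsub>G\<^esub> i \<otimes>\<^bsub>G\<^esub> \<beta>"
proof -
  obtain i j l :: nat where x: "x = a [^]\<^bsub>G\<^esub> i \<otimes>\<^bsub>G\<^esub> b [^]\<^bsub>G\<^esub> j \<otimes>\<^bsub>G\<^esub> 1 [^]\<^bsub>G\<^esub> l"
    using generating[OF assms] by blast
  have "b [^]\<^bsub>G\<^esub> j \<in> B" "1 [^]\<^bsub>G\<^esub> l \<in> B"
    by (rule G.subgroup_nat_pow_closed[OF subgroup_B]; simp)+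
  then have "b [^]\<^bsub>G\<^esub> j \<otimes>\<^bsub>G\<^esub> 1 [^]\<^bsub>G\<^esub> l \<in> B" by (rule subgroup.m_closed[OF subgroup_B])
  moreover have "x = a [^]\<^bsub>G\<^esub> i \<otimes>\<^bsub>G\<^esub> (b [^]\<^bsub>G\<^esub> j \<otimes>\<^bsub>G\<^esub> 1 [^]\<^bsub>G\<^esub> l)"
    unfolding x by (rule G.m_assoc; rule G.nat_pow_closed; simp add: a_in b_in)
  ultimately show ?thesis by blast
qed

text \<open>
  Such a subgroup meets \<open>B\<close> in \<open>{0, 1}\<close> only, while modulo \<open>B\<close> it is cyclic like the whole group.
\<close>

lemma subgroup_cyclic_mod_0_1:
  assumes H: "subgroup H G" "1 \<in> H" "b \<notin> H"
  obtains c where "c \<in> H" "\<And>x. x \<in> H \<Longrightarrow> \<exists>i::nat. \<exists>\<beta>\<in>{0, 1}. x = c [^]\<^bsub>G\<^esub> i \<otimes>\<^bsub>G\<^esub> \<beta>"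
proof -
  have "b + 1 \<notin> H"
  proof
    assume "b + 1 \<in> H"
    then have "1 \<otimes>\<^bsub>G\<^esub> (b + 1) \<in> H" by (rule subgroup.m_closed[OF H(1,2)])
    moreover have "1 + (b + 1) = b" by (metis add.commute add.left_commute vec_add_cancel2)
    ultimately show False using H by simp
  qed
  then have BH: "B \<inter> H \<subseteq> {0, 1}" using H by auto
  obtain c where c: "c \<in> H"
    and gen: "\<And>x. x \<in> H \<Longrightarrow> \<exists>i::nat. \<exists>\<beta>\<in>B \<inter> H. x = c [^]\<^bsub>G\<^esub> i \<otimes>\<^bsub>G\<^esub> \<beta>"
  proof (rule G.subgroup_over_cyclic_quotient[OF _ H(1) subgroup_B])
    show "a \<in> carrier G" using a_in by simp
    show "\<exists>i::nat. \<exists>\<beta>\<in>B. x = a [^]\<^bsub>G\<^esub> i \<otimes>\<^bsub>G\<^esub> \<beta>" if "x \<in> carrier G" for x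
      by (rule generated) (use that in simp)
  qed simp_all
  show thesis
  proof (rule that[OF c])
    fix x assume "x \<in> H"
    then obtain i :: nat and \<beta> where "\<beta> \<in> B \<inter> H" "x = c [^]\<^bsub>G\<^esub> i \<otimes>\<^bsub>G\<^esub> \<beta>"
      using gen by blast
    then show "\<exists>i::nat. \<exists>\<beta>\<in>{0, 1}. x = c [^]\<^bsub>G\<^esub> i \<otimes>\<^bsub>G\<^esub> \<beta>" using BH by (intro exI bexI) auto
  qed
qed

text \<open>
  If \<open>K \<noteq> C\<close>, an element \<open>z\<close> of \<open>Stab\<close> outside \<open>K\<close> with constant square exists, and \<open>K\<close> meets
  \<open>Stab\<close> in \<open>{0, 1}\<close> only. If \<open>b \<notin> K\<close>, then modulo \<open>{0, 1}\<close> the kernel is cyclic of order \<open>2^(k-1)\<close>,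
  although the orders of its elements divide \<open>2^(k-2)\<close>. If \<open>b \<in> K\<close>, then \<open>K\<close> contains an element of
  order 2 modulo \<open>B\<close>; as there is only one, \<open>z\<close> lies in \<open>K\<close>.
\<close>

lemma kernel_eq_code_if_card_ge:
  assumes K: "card K = 2 ^ k" and k: "4 \<le> k"
  shows "K = C"
proof (rule ccontr)
  assume nonlinear: "K \<noteq> C"
  define d where "d = k - 2"
  have d: "k = d + 2" "2 \<le> d" using k by (simp_all add: d_def)
  have "d + 2 \<le> 2 ^ d" using d(2)
  proof (induction d rule: dec_induct)
    case (step n) then show ?case by simp
  qed simp
  then have k_le: "k \<le> 2 ^ d" using d by simp
  have pow: "x [^]\<^bsub>G\<^esub> (2 ^ d :: nat) \<in> Stab" if "x \<in> C" for x using pow_in_Stab[OF K k_le that] .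
  \<comment> \<open>Otherwise \<open>G / Stab\<close>, of order \<open>2^(k-1)\<close>, would be generated by \<open>a\<close>, of order at most \<open>2^(k-2)\<close>.\<close>
  have "b \<notin> Stab"
  proof
    assume "b \<in> Stab"
    then have "1 \<otimes>\<^bsub>G\<^esub> b \<in> Stab" by (rule subgroup.m_closed[OF subgroup_Stab one_in_Stab])
    then have "B \<subseteq> Stab" using \<open>b \<in> Stab\<close> subgroup.one_closed[OF subgroup_Stab] by (simp add: add.commute)
    then have gen: "\<exists>i::nat. \<exists>\<beta>\<in>Stab. x = a [^]\<^bsub>G\<^esub> i \<otimes>\<^bsub>G\<^esub> \<beta>" if "x \<in> C" for x using generated[OF that] by blast
    have "card C \<le> 2 ^ d * card Stab"
      by (rule G.card_cyclic_extension_le[OF subgroup_Stab _ _ _ pow[OF a_in]])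
        (simp, simp add: a_in, simp, erule gen)
    moreover have "card Stab * 2 ^ d * 4 = 2 * card C" using card_Stab_mult_card_kernel K d by (simp add: power_add)
    moreover have "0 < card C" by (auto simp: card_gt_0_iff intro: zero_in)
    ultimately show False by (simp add: mult.commute)
  qed
  then obtain c where "c \<in> Stab" "\<And>x. x \<in> Stab \<Longrightarrow> \<exists>i::nat. \<exists>\<beta>\<in>{0, 1}. x = c [^]\<^bsub>G\<^esub> i \<otimes>\<^bsub>G\<^esub> \<beta>"
    using subgroup_cyclic_mod_0_1[OF subgroup_Stab one_in_Stab] by blast
  then obtain z where z: "z \<in> Stab" "z \<notin> K" "z \<otimes>\<^bsub>G\<^esub> z \<in> {0, 1}" and SK: "Stab \<inter> K = {0, 1}"
    using cyclic_stabiliser_half_power[OF nonlinear] by blast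
  have card_K: "16 \<le> card K" using K k power_increasing[of 4 k "2::nat"] by simp
  show False
  proof (cases "b \<in> K")
    case False
    then obtain c where c: "c \<in> K" and gen: "\<And>x. x \<in> K \<Longrightarrow> \<exists>i::nat. \<exists>\<beta>\<in>{0, 1}. x = c [^]\<^bsub>G\<^esub> i \<otimes>\<^bsub>G\<^esub> \<beta>"
      using subgroup_cyclic_mod_0_1[OF subgroup_kernel one_in_kernel] by blast
    have c_pow: "c [^]\<^bsub>G\<^esub> (2 ^ d :: nat) \<in> {0, 1}"
      using pow[OF kernel_in[OF c]] G.subgroup_nat_pow_closed[OF subgroup_kernel c] SK by blast
    have "card K \<le> 2 ^ d * card {0 :: bit ^ 'n, 1}"
      by (rule G.card_cyclic_extension_le[OF subgroup_0_1 _ _ _ c_pow])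
        (simp, simp add: kernel_in[OF c], simp, erule gen)
    also have "\<dots> \<le> 2 ^ d * 2" by (intro mult_left_mono) (simp_all add: card_insert_if)
    finally show False using K d by (simp add: power_add)
  next
    case True
    then have BK: "B \<subseteq> K" using kernel_add by auto
    have "card B \<le> 4" by (simp add: card_insert_if)
    then have "\<not> K \<subseteq> B" using card_K card_mono[of B K] by (intro notI) simp
    then obtain x where "x \<in> K" "x \<notin> B" by blast
    then obtain w where w: "w \<in> K" "w \<notin> B" "w \<otimes>\<^bsub>G\<^esub> w \<in> B"
      using G.involution_mod_subgroup_exists[OF subgroup_kernel K subgroup_B] by blast
    have "z \<otimes>\<^bsub>G\<^esub> w \<in> B"
      by (rule G.mult_involutions_mod_subgroup[OF _ subgroup_B, of a])
        (simp, simp add: a_in, rule generated, simp, simp add: Stab_in[OF z(1)], use z BK in blast,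
          use z in blast, simp add: kernel_in[OF w(1)], rule w(2), rule w(3))
    then have "z \<otimes>\<^bsub>G\<^esub> w \<in> K" using BK by blast
    then have "z \<in> K"
      by (rule G.subgroup_mult_cancel_right[OF subgroup_kernel _ w(1)]) (use z Stab_in in simp)
    then show False using z by simp
  qed
qed

end

section \<open>The three types of codes\<close>

lemma comm_group_DirProd:
  assumes "comm_group G" "comm_group H"
  shows "comm_group (G \<times>\<times> H)"
proof -
  interpret G: comm_group G by fact
  interpret H: comm_group H by fact
  interpret GH: group "G \<times>\<times> H" by (rule DirProd_group) (rule G.is_group H.is_group)+
  show ?thesis
    by (rule GH.group_comm_groupI) (auto simp: G.m_comm H.m_comm)
qed

context group
begin

lemma comm_group_subgroup_generated_singleton: "comm_group (subgroup_generated G {x})"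
  using group_subgroup_generated cyclic_group_generated by (rule group.cyclic_imp_abelian_group)

lemma carrier_subgroup_generated_singleton_nat:
  assumes "finite (carrier G)" "x \<in> carrier G" "y \<in> carrier (subgroup_generated G {x})"
  obtains i :: nat where "y = x [^] i"
proof -
  have "ord x \<noteq> 0" using ord_ge_1[OF assms(1,2)] by simp
  then show thesis using that assms by (auto simp: carrier_subgroup_generated generate_pow_nat)
qed

lemma direct_product2_generated:
  assumes fin: "finite (carrier G)" and dp: "direct_product2 G a b"
  shows "comm_group G" and "x \<in> carrier G \<Longrightarrow> \<exists>(i::nat) (j::nat). x = a [^] i \<otimes> b [^] j"
proof -
  let ?D = "subgroup_generated G {a} \<times>\<times> subgroup_generated G {b}"
  have iso: "(\<lambda>(x, y). x \<otimes> y) \<in> iso ?D G" and ab: "a \<in> carrier G" "b \<in> carrier G"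
    using dp by (simp_all add: direct_product2_def)
  have "comm_group ?D" by (intro comm_group_DirProd comm_group_subgroup_generated_singleton)
  then show "comm_group G"
    by (rule comm_group.iso_imp_comm_group) (use iso is_monoid in \<open>auto simp: is_iso_def\<close>)
  assume "x \<in> carrier G"
  then have "x \<in> (\<lambda>(x, y). x \<otimes> y) ` carrier ?D" using iso by (simp add: iso_def bij_betw_def)
  then show "\<exists>(i::nat) (j::nat). x = a [^] i \<otimes> b [^] j"
    using carrier_subgroup_generated_singleton_nat[OF fin] ab by auto metis
qed

lemma direct_product3_generated:
  assumes fin: "finite (carrier G)" and dp: "direct_product3 G a b c"
  shows "comm_group G" and "x \<in> carrier G \<Longrightarrow> \<exists>(i::nat) (j::nat) (l::nat). x = a [^] i \<otimes> b [^] j \<otimes> c [^] l"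
proof -
  let ?D = "subgroup_generated G {a} \<times>\<times> subgroup_generated G {b} \<times>\<times> subgroup_generated G {c}"
  have iso: "(\<lambda>(x, y, z). x \<otimes> y \<otimes> z) \<in> iso ?D G"
    and abc: "a \<in> carrier G" "b \<in> carrier G" "c \<in> carrier G"
    using dp by (simp_all add: direct_product3_def)
  have "comm_group ?D" by (intro comm_group_DirProd comm_group_subgroup_generated_singleton)
  then show "comm_group G"
    by (rule comm_group.iso_imp_comm_group) (use iso is_monoid in \<open>auto simp: is_iso_def\<close>)
  assume "x \<in> carrier G"
  then have "x \<in> (\<lambda>(x, y, z). x \<otimes> y \<otimes> z) ` carrier ?D" using iso by (simp add: iso_def bij_betw_def)
  then show "\<exists>(i::nat) (j::nat) (l::nat). x = a [^] i \<otimes> b [^] j \<otimes> c [^] l"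
    using carrier_subgroup_generated_singleton_nat[OF fin] abc by auto metis
qed

lemma square_eq_one_if_iso_mod_2:
  assumes "x \<in> carrier G" "subgroup_generated G {x} \<cong> integer_mod_group 2"
  shows "x \<otimes> x = \<one>"
proof -
  let ?H = "subgroup_generated G {x}"
  interpret H: group ?H by (rule group_subgroup_generated)
  have "order ?H = 2"
    using iso_same_card[OF assms(2)] by (simp add: order_def carrier_integer_mod_group)
  moreover have "x \<in> carrier ?H" using assms(1) by (simp add: carrier_subgroup_generated generate.incl)
  ultimately have "x [^]\<^bsub>?H\<^esub> (2::nat) = \<one>\<^bsub>?H\<^esub>" using H.pow_order_eq_1[of x] by simp
  then show ?thesis using assms(1) by (simp add: numeral_2_eq_2)
qed

end

lemma abelian_hfp_two_generated_cases:
  assumes "HFP_2t_2_2u t C \<pi> \<or> HFP_2t_4u t C \<pi> \<or> HFP_4tu_2 t C \<pi>"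
  obtains a b where "abelian_hfp_two_generated C \<pi> a b"
proof -
  let ?G = "code_group C \<pi>"
  have hfp: "HFP_code C \<pi>" using assms by (auto simp: HFP_2t_2_2u_def HFP_2t_4u_def HFP_4tu_2_def)
  interpret G: group ?G
    using hfp by (intro group_code_group) (auto simp: HFP_code_def hadamard_code_def)
  have car: "carrier ?G = C" and one: "\<one>\<^bsub>?G\<^esub> = 0" by (simp_all add: code_group_def)
  have fin: "finite (carrier ?G)" by (simp add: car)
  note witness = that
  have main: thesis if ab: "a \<in> C" "b \<in> C" and comm: "comm_group ?G" and b2: "b \<otimes>\<^bsub>?G\<^esub> b \<in> {0, 1}"
    and gen: "\<And>x. x \<in> C \<Longrightarrow>
      \<exists>(i::nat) (j::nat) (l::nat). x = a [^]\<^bsub>?G\<^esub> i \<otimes>\<^bsub>?G\<^esub> b [^]\<^bsub>?G\<^esub> j \<otimes>\<^bsub>?G\<^esub> 1 [^]\<^bsub>?G\<^esub> l" for a b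
    by (rule witness[of a b]) (intro abelian_hfp_two_generated.intro abelian_hfp.intro
      abelian_hfp_two_generated_axioms.intro hfp comm ab b2 gen)
  have two: thesis if dp: "direct_product2 ?G a b" and b2: "b [^]\<^bsub>?G\<^esub> (2::nat) \<in> {0, 1}" for a b
  proof (rule main)
    show ab: "a \<in> C" "b \<in> C" using dp by (simp_all add: direct_product2_def car)
    show "comm_group ?G" by (rule G.direct_product2_generated(1)[OF fin dp])
    show "b \<otimes>\<^bsub>?G\<^esub> b \<in> {0, 1}" using b2 ab by (simp add: numeral_2_eq_2 car)
    fix x assume "x \<in> C"
    then obtain i j :: nat where x: "x = a [^]\<^bsub>?G\<^esub> i \<otimes>\<^bsub>?G\<^esub> b [^]\<^bsub>?G\<^esub> j"
      using G.direct_product2_generated(2)[OF fin dp, of x] by (auto simp: car)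
    have "a [^]\<^bsub>?G\<^esub> i \<otimes>\<^bsub>?G\<^esub> b [^]\<^bsub>?G\<^esub> j \<in> carrier ?G"
      using ab by (intro G.m_closed G.nat_pow_closed) (simp_all add: car)
    then have "x = a [^]\<^bsub>?G\<^esub> i \<otimes>\<^bsub>?G\<^esub> b [^]\<^bsub>?G\<^esub> j \<otimes>\<^bsub>?G\<^esub> 1 [^]\<^bsub>?G\<^esub> (0::nat)"
      by (simp add: x)
    then show "\<exists>(i::nat) (j::nat) (l::nat). x = a [^]\<^bsub>?G\<^esub> i \<otimes>\<^bsub>?G\<^esub> b [^]\<^bsub>?G\<^esub> j \<otimes>\<^bsub>?G\<^esub> 1 [^]\<^bsub>?G\<^esub> l" by blast
  qed
  from assms consider "HFP_2t_2_2u t C \<pi>" | "HFP_2t_4u t C \<pi>" | "HFP_4tu_2 t C \<pi>" by blast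
  then show thesis
  proof cases
    case 1
    then obtain a b where dp: "direct_product3 ?G a b 1"
      and b: "subgroup_generated ?G {b} \<cong> integer_mod_group 2"
      unfolding HFP_2t_2_2u_def Let_def by blast
    show thesis
    proof (rule main)
      show ab: "a \<in> C" "b \<in> C" using dp by (simp_all add: direct_product3_def car)
      show "comm_group ?G" by (rule G.direct_product3_generated(1)[OF fin dp])
      show "b \<otimes>\<^bsub>?G\<^esub> b \<in> {0, 1}" using G.square_eq_one_if_iso_mod_2[OF _ b] ab by (simp add: car one)
    qed (use G.direct_product3_generated(2)[OF fin dp] car in simp)
  next
    case 2
    then show thesis unfolding HFP_2t_4u_def Let_def using two by (metis insertCI)
  next
    case 3
    then show thesis unfolding HFP_4tu_2_def Let_def using two by (metis insertCI)
  qed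
qed

theorem theorem3p5:
  fixes C :: "(bit ^ 'n) set" and \<pi> :: "bit ^ 'n \<Rightarrow> 'n \<Rightarrow> 'n" and t :: nat
  assumes "HFP_2t_2_2u t C \<pi> \<or> HFP_2t_4u t C \<pi> \<or> HFP_4tu_2 t C \<pi>"
    and "\<not> vec.subspace C"
  shows "vec.dim (code_kernel C) \<le> 3"
proof (rule ccontr)
  assume "\<not> vec.dim (code_kernel C) \<le> 3"
  then have "4 \<le> vec.dim (code_kernel C)" by simp
  moreover obtain a b where "abelian_hfp_two_generated C \<pi> a b"
    using abelian_hfp_two_generated_cases[OF assms(1)] .
  moreover have "card (code_kernel C) = 2 ^ vec.dim (code_kernel C)"
    by (rule card_vec_subspace[OF subspace_code_kernel])
  ultimately have "code_kernel C = C"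
    by (metis abelian_hfp_two_generated.kernel_eq_code_if_card_ge)
  then show False using subspace_code_kernel[of C] assms(2) by simp
qed

end
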